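(* Let $(\mathcal{G}_N)_{N\in\mathbb{N}}$ be a dynamic network model that satisfies Assumption $\mathrm{PA}(\gamma)$ for some $\gamma$ satisfying $\frac12<\gamma<1$. Then, for random vertices $V$ and $W$ chosen independently and uniformly from $[N]$, we have $$d_N(V,W)\ \ge\ 4\,\frac{\log\log N}{\log\big(\frac{\gamma}{1-\gamma}\big)}+\mathcal{O}(1)\qquad\text{with high probability.}$$
   Context: $[N]=\{1,2,\dots,N\}$, $a\wedge b=\min\{a,b\}$, $a\vee b=\max\{a,b\}$. A (dynamic) network model is a sequence of random graphs $(\mathcal{G}_N)_{N\in\mathbb{N}}$ where $\mathcal{G}_N$ has vertex set $[N]$ and its set of unoriented edges is a random symmetric subset of $[N]\times[N]$ (multiple edges between the same pair of vertices are occasionally allowed, but have no bearing on distances). Write $v\leftrightarrow w$ if the vertices $v,w$ are connected by an edge in $\mathcal{G}_N$; $v_0\leftrightarrow v_1\leftrightarrow\cdots\leftrightarrow v_\ell$ means that $v_{k-1}\leftrightarrow v_k$ for all $1\le k\le\ell$. The graph distance is $d_N(v,w)=\min\{n: \exists\, v=v_0,v_1,\dots,v_n=w\in\mathcal{G}_N \text{ such that } v_{i-1}\leftrightarrow v_i \text{ for all } 1\le i\le n\}$. Assumption $\mathrm{PA}(\gamma)$: there exists $\kappa$ such that, for all $N$ and pairwise distinct vertices $v_0,\dots,v_\ell\in[N]$, $$\mathbb{P}\big\{v_0\leftrightarrow v_1\leftrightarrow v_2\leftrightarrow\cdots\leftrightarrow v_\ell\big\}\le \prod_{k=1}^{\ell}\kappa\,(v_{k-1}\wedge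 v_k)^{-\gamma}\,(v_{k-1}\vee v_k)^{\gamma-1}.$$ "With high probability" means with probability tending to $1$ as $N\to\infty$.
   Formalization: The O(1) term is read as bounded in probability: for every ε>0 there is a constant C, which may depend on ε, such that the bound with −C holds with probability at least 1−ε for all large N; with a single constant and probability tending to 1 the claim fails. *)

theory Defs
  imports "HOL-Probability.Probability"
begin

definition graphs_on :: "nat \<Rightarrow> (nat \<times> nat) set set" where
  "graphs_on N = {E. E \<subseteq> {1..N} \<times> {1..N} \<and> sym E}"

definition network_model :: "(nat \<Rightarrow> 'a measure) \<Rightarrow> (nat \<Rightarrow> 'a \<Rightarrow> (nat \<times> nat) set) \<Rightarrow> bool" where
  "network_model M G \<longleftrightarrow>
     (\<forall>N\<ge>1. prob_space (M N) \<and> G N \<in> measurable (M N) (count_space (graphs_on N)))"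

text \<open>\<open>v 0 \<leftrightarrow> v 1 \<leftrightarrow> \<dots> \<leftrightarrow> v l\<close>; only the values of \<open>v\<close> on \<open>{0..l}\<close> matter.\<close>

definition linked :: "(nat \<times> nat) set \<Rightarrow> (nat \<Rightarrow> nat) \<Rightarrow> nat \<Rightarrow> bool" where
  "linked E v l \<longleftrightarrow> (\<forall>k\<in>{1..l}. (v (k - 1), v k) \<in> E)"

text \<open>The distance is \<open>\<infinity>\<close> between vertices in different components, as \<open>Inf {} = \<infinity>\<close> in \<open>enat\<close>.\<close>

definition graph_dist :: "nat \<Rightarrow> (nat \<times> nat) set \<Rightarrow> nat \<Rightarrow> nat \<Rightarrow> enat" where
  "graph_dist N E v w =
     Inf {enat n | n. \<exists>p. p 0 = v \<and> p n = w \<and> p ` {0..n} \<subseteq> {1..N} \<and> linked E p n}"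

definition PA :: "real \<Rightarrow> (nat \<Rightarrow> 'a measure) \<Rightarrow> (nat \<Rightarrow> 'a \<Rightarrow> (nat \<times> nat) set) \<Rightarrow> bool" where
  "PA \<gamma> M G \<longleftrightarrow>
     (\<exists>\<kappa>::real. \<forall>N l v. v ` {0..l} \<subseteq> {1..N} \<longrightarrow> inj_on v {0..l} \<longrightarrow>
        measure (M N) {\<omega> \<in> space (M N). linked (G N \<omega>) v l}
          \<le> (\<Prod>k = 1..l. \<kappa> * real (min (v (k - 1)) (v k)) powr (- \<gamma>)
                            * real (max (v (k - 1)) (v k)) powr (\<gamma> - 1)))"

text \<open>\<open>V N\<close> and \<open>W N\<close> are uniform on \<open>{1..N}\<close>, and \<open>G N\<close>, \<open>V N\<close>, \<open>W N\<close> are independent. Independence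
  is expressed through the joint law because \<open>indep_vars\<close> needs all variables to have the same type.\<close>

definition uniform_vertices ::
  "(nat \<Rightarrow> 'a measure) \<Rightarrow> (nat \<Rightarrow> 'a \<Rightarrow> (nat \<times> nat) set) \<Rightarrow>
     (nat \<Rightarrow> 'a \<Rightarrow> nat) \<Rightarrow> (nat \<Rightarrow> 'a \<Rightarrow> nat) \<Rightarrow> bool" where
  "uniform_vertices M G V W \<longleftrightarrow>
     (\<forall>N\<ge>1. V N \<in> measurable (M N) (count_space {1..N}) \<and>
            W N \<in> measurable (M N) (count_space {1..N}) \<and>
            distr (M N) (count_space (graphs_on N) \<Otimes>\<^sub>M (count_space {1..N} \<Otimes>\<^sub>M count_space {1..N}))
                (\<lambda>\<omega>. (G N \<omega>, V N \<omega>, W N \<omega>))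
              = distr (M N) (count_space (graphs_on N)) (G N)
                  \<Otimes>\<^sub>M (uniform_count_measure {1..N} \<Otimes>\<^sub>M uniform_count_measure {1..N}))"

text \<open>\<open>X N \<ge> a N + O(1)\<close> with high probability, where the \<open>O(1)\<close> term is bounded in probability:
  the constant may depend on the error probability \<open>\<epsilon>\<close>. A constant uniform in \<open>\<epsilon>\<close> is not available
  for typical distances: with probability at least \<open>\<epsilon>\<^sup>2\<close> both random vertices have index at most
  \<open>\<epsilon>N\<close> (up to rounding), which in general shortens the distance by an amount of order \<open>ln (ln (1/\<epsilon>))\<close>.\<close>

definition whp_ge_plus_O1 ::
  "(nat \<Rightarrow> 'a measure) \<Rightarrow> (nat \<Rightarrow> 'a \<Rightarrow> enat) \<Rightarrow> (nat \<Rightarrow> real) \<Rightarrow> bool" where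
  "whp_ge_plus_O1 M X a \<longleftrightarrow>
     (\<forall>\<epsilon>>0. \<exists>C::real. \<forall>\<^sub>F N in sequentially.
        measure (M N) {\<omega> \<in> space (M N). ereal_of_enat (X N \<omega>) \<ge> ereal (a N - C)} \<ge> 1 - \<epsilon>)"

text \<open>Equivalently, with probability tending to 1 the bound holds up to any error term tending to
  infinity, however slowly.\<close>

lemma whp_ge_plus_O1_iff:
  assumes P: "\<And>N. N \<ge> 1 \<Longrightarrow> prob_space (M N)"
    and X: "\<And>N. N \<ge> 1 \<Longrightarrow> X N \<in> measurable (M N) (count_space UNIV)"
  shows "whp_ge_plus_O1 M X a \<longleftrightarrow>
    (\<forall>b::nat \<Rightarrow> real. filterlim b at_top sequentially \<longrightarrow>
       (\<lambda>N. measure (M N) {\<omega> \<in> space (M N). ereal_of_enat (X N \<omega>) \<ge> ereal (a N - b N)})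
         \<longlonglongrightarrow> 1)"
proof -
  define p where "p N c = measure (M N) {\<omega> \<in> space (M N). ereal_of_enat (X N \<omega>) \<ge> ereal (a N - c)}"
    for N c
  have ev: "{\<omega> \<in> space (M N). ereal_of_enat (X N \<omega>) \<ge> ereal (a N - c)} \<in> sets (M N)"
    if "N \<ge> 1" for N c
  proof -
    have "X N -` {x. ereal_of_enat x \<ge> ereal (a N - c)} \<inter> space (M N) \<in> sets (M N)"
      by (rule measurable_sets[OF X[OF that]]) simp
    thus ?thesis by (simp add: vimage_def Int_def conj_commute)
  qed
  have mono: "p N c \<le> p N c'" if "c \<le> c'" "N \<ge> 1" for N c c'
  proof -
    interpret prob_space "M N" by (rule P[OF that(2)])
    have "ereal (a N - c') \<le> ereal (a N - c)" using that by simp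
    hence "{\<omega> \<in> space (M N). ereal_of_enat (X N \<omega>) \<ge> ereal (a N - c)} \<subseteq>
        {\<omega> \<in> space (M N). ereal_of_enat (X N \<omega>) \<ge> ereal (a N - c')}"
      using order_trans by blast
    thus ?thesis unfolding p_def by (intro finite_measure_mono ev that)
  qed
  have le1: "p N c \<le> 1" if "N \<ge> 1" for N c
    unfolding p_def by (rule prob_space.prob_le_1[OF P[OF that]])
  have "(\<forall>\<epsilon>>0. \<exists>C. \<forall>\<^sub>F N in sequentially. p N C \<ge> 1 - \<epsilon>) \<longleftrightarrow>
    (\<forall>b. filterlim b at_top sequentially \<longrightarrow> (\<lambda>N. p N (b N)) \<longlonglongrightarrow> 1)" (is "?L \<longleftrightarrow> ?R")
  proof
    assume L: ?L
    show ?R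
    proof (intro allI impI)
      fix b :: "nat \<Rightarrow> real" assume b: "filterlim b at_top sequentially"
      show "(\<lambda>N. p N (b N)) \<longlonglongrightarrow> 1"
      proof (rule order_tendstoI)
        fix y :: real assume "y < 1"
        hence "(1 - y) / 2 > 0" by simp
        then obtain C where C: "\<forall>\<^sub>F N in sequentially. p N C \<ge> 1 - (1 - y) / 2"
          using L by blast
        have "\<forall>\<^sub>F N in sequentially. b N \<ge> C"
          using b by (simp add: filterlim_at_top)
        with C eventually_ge_at_top[of "1::nat"] show "\<forall>\<^sub>F N in sequentially. y < p N (b N)"
        proof eventually_elim
          case (elim N)
          have "y < 1 - (1 - y) / 2" using \<open>y < 1\<close> by (simp add: field_simps)
          thus ?case using elim mono[of C "b N" N] by linarith
        qed
      next
        fix y :: real assume "1 < y"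
        show "\<forall>\<^sub>F N in sequentially. p N (b N) < y"
          using eventually_ge_at_top[of "1::nat"]
          by eventually_elim (use le1 \<open>1 < y\<close> in \<open>fastforce intro: le_less_trans\<close>)
      qed
    qed
  next
    assume R: ?R
    show ?L
    proof (rule ccontr)
      assume "\<not> ?L"
      then obtain e where e: "e > 0" "\<And>C. \<exists>\<^sub>F N in sequentially. p N C < 1 - e"
        by (auto simp: not_eventually not_le)
      have ex: "\<exists>N\<ge>n. p N C < 1 - e" for n C
        using e(2)[of C] by (auto simp: frequently_sequentially)
      have "\<exists>s. \<forall>k. (s k \<ge> 1 \<and> p (s k) (real k) < 1 - e) \<and> s k < s (Suc k)"
      proof (rule dependent_nat_choice)
        show "\<exists>x\<ge>1. p x (real 0) < 1 - e" using ex by blast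
      next
        fix x n assume "1 \<le> x \<and> p x (real n) < 1 - e"
        show "\<exists>y. (1 \<le> y \<and> p y (real (Suc n)) < 1 - e) \<and> x < y"
          using ex[of "Suc x" "real (Suc n)"]
          by (metis Suc_le_lessD Suc_leI le0 le_less_trans One_nat_def)
      qed
      then obtain s where s: "\<And>k. s k \<ge> 1" "\<And>k. p (s k) (real k) < 1 - e" "\<And>k. s k < s (Suc k)"
        by blast
      have sm: "strict_mono s" using s(3) by (simp add: strict_mono_Suc_iff)
      define b where "b N = real (LEAST k. N \<le> s k)" for N
      have bs: "b (s k) = real k" for k
        unfolding b_def
        using sm by (auto intro!: Least_equality simp: strict_mono_less_eq)
      have "filterlim b at_top sequentially"
        unfolding filterlim_at_top
      proof
        fix Z :: real
        obtain m :: nat where m: "Z \<le> real m" using real_arch_simple by blast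
        have "Z \<le> b N" if "N \<ge> s m" for N
        proof -
          have "N \<le> s N" using seq_suble[OF sm] .
          hence "N \<le> s (LEAST k. N \<le> s k)" by (rule LeastI)
          with that have "s m \<le> s (LEAST k. N \<le> s k)" by linarith
          hence "m \<le> (LEAST k. N \<le> s k)" using sm by (simp add: strict_mono_less_eq)
          thus ?thesis using m unfolding b_def by linarith
        qed
        thus "\<forall>\<^sub>F N in sequentially. Z \<le> b N"
          using eventually_sequentially by blast
      qed
      hence "(\<lambda>N. p N (b N)) \<longlonglongrightarrow> 1" using R by blast
      hence "((\<lambda>N. p N (b N)) \<circ> s) \<longlonglongrightarrow> 1" by (rule LIMSEQ_subseq_LIMSEQ[OF _ sm])
      hence "1 \<le> 1 - e"
        by (rule LIMSEQ_le_const2) (use s(2) bs in \<open>auto intro!: exI[of _ 0] less_imp_le\<close>)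
      thus False using e(1) by simp
    qed
  qed
  thus ?thesis by (simp add: whp_ge_plus_O1_def p_def)
qed

end

theory Submission
  imports Defs "HOL-Real_Asymp.Real_Asymp"
begin

text \<open>
  The proof is a first moment estimate for paths of length at most \<open>2h\<close>, where
  \<open>h = ln (ln N) / ln r - O(1)\<close> and \<open>r = sqrt (\<gamma> / (1 - \<gamma>))\<close>; as \<open>ln (\<gamma> / (1 - \<gamma>)) = 2 ln r\<close>, the number
  \<open>2h\<close> is the claimed lower bound. The expected number of all such paths is far too large, since it is
  dominated by rare configurations in which the first few vertices are already very old (have a very
  small index). Hence paths are followed from both ends, and a path is abandoned as soon as its
  \<open>k\<close>-th vertex, counted from the end in question, lies below a threshold \<open>\<tau> k\<close>. The thresholds decrease so quickly that
  a path is unlikely to be abandoned, and so slowly that no threshold up to \<open>\<tau> h\<close> comes close to the oldest vertices.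

  The key estimate is for the total weight of the paths of length \<open>k\<close> from \<open>v\<close> to \<open>u\<close> whose vertex
  number \<open>j\<close> is at least \<open>\<tau> j\<close> for every \<open>j < k\<close>. Regardless of \<open>v\<close> it is at most
  \<open>\<alpha> k u\<^sup>-\<^sup>\<gamma>\<close>, plus \<open>\<beta> k u\<^sup>\<gamma>\<^sup>-\<^sup>1\<close> if \<open>u > \<tau> (k - 1)\<close>: the first term collects the last
  steps to an older vertex, the second the last steps to a younger one. Summing out the last vertex gives, up to a
  constant factor,

    \<open>\<alpha> (k + 1) = \<alpha> k ln (N / \<tau> k) + \<beta> k N\<^sup>2\<^sup>\<gamma>\<^sup>-\<^sup>1\<close> and
    \<open>\<beta> (k + 1) = \<alpha> k (\<tau> k)\<^sup>1\<^sup>-\<^sup>2\<^sup>\<gamma> + \<beta> k ln (N / \<tau> k)\<close>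

  (lemma \<open>path_sum_le\<close>). The weight of the paths that first fall below a threshold in step \<open>k\<close> is at most
  \<open>\<alpha> k (\<tau> k)\<^sup>1\<^sup>-\<^sup>\<gamma> / (1 - \<gamma>)\<close>. Requiring this to be of order \<open>2\<^sup>-\<^sup>k\<close> and writing \<open>\<tau> k = N exp (- x k)\<close>,
  the dominant effect of two steps is \<open>(1 - \<gamma>) x (k + 2) = \<gamma> x k\<close>, so that \<open>x k\<close> grows like \<open>A r\<^sup>k\<close>.
  An older vertex is a hub that is reached through a young connector, which is why the
  exponent gains the factor \<open>\<gamma> / (1 - \<gamma>)\<close> only every second step. With \<open>x k = A r\<^sup>k - B\<close> for suitable
  constants \<open>A\<close> and \<open>B\<close> the recursions hold without any further correction: the logarithmic
  factors are absorbed because \<open>x (k + 1) - x k\<close> is of the order of \<open>A r\<^sup>k\<close>, and the constant factors are absorbed by \<open>exp B\<close>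
  (lemmas \<open>old_coeff_step\<close>, \<open>young_coeff_step\<close> and \<open>threshold_path_sum_le\<close>).

  A path that is never abandoned splits at its middle vertex \<open>u\<close> into two truncated paths, from \<open>v\<close>
  and from \<open>w\<close>. As long as \<open>A r\<^sup>h\<^sup>+\<^sup>1\<close> is at most a small multiple of \<open>ln N\<close>, which is the condition
  that determines \<open>h\<close>, the sum over \<open>u\<close> of the product of the two bounds is a negative power of
  \<open>N\<close> (lemma \<open>meeting_weight_le\<close>). Altogether, the distance is at most \<open>2h\<close> with small probability
  whenever \<open>v\<close> and \<open>w\<close> are distinct and above \<open>\<tau> 0 = N exp (B - A)\<close>, and uniformly chosen vertices
  violate these conditions with probability at most \<open>2 exp (B - A) + 1 / N\<close>.
\<close>

section \<open>Sums of powers\<close>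

text \<open>By the mean value theorem each summand is at most the increment of the antiderivative over the
  unit interval to its left. The first summand is kept separate because for \<open>L = 1\<close> that
  interval leaves the range in which \<open>\<Phi>\<close> is an antiderivative.\<close>

lemma sum_le_antiderivative:
  fixes \<Phi> \<phi> :: "real \<Rightarrow> real" and L n :: nat
  assumes deriv: "\<And>x. x \<ge> 1 \<Longrightarrow> (\<Phi> has_real_derivative \<phi> x) (at x)"
    and anti: "\<And>x y. 1 \<le> x \<Longrightarrow> x \<le> y \<Longrightarrow> \<phi> y \<le> \<phi> x"
    and L: "1 \<le> L" "L \<le> n"
  shows "(\<Sum>m=L..n. \<phi> (real m)) \<le> \<phi> (real L) + (\<Phi> (real n) - \<Phi> (real L))"
  using L(2)
proof (induction n rule: dec_induct)
  case (step n)
  have "\<exists>z>real n. z < real (Suc n) \<and> \<Phi> (real (Suc n)) - \<Phi> (real n) = (real (Suc n) - real n) * \<phi> z"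
    using L(1) step.hyps by (intro MVT2 deriv) auto
  then obtain z where z: "z > real n" "z < real (Suc n)" "\<Phi> (real (Suc n)) - \<Phi> (real n) = \<phi> z"
    by auto
  have "\<phi> (real (Suc n)) \<le> \<phi> z"
    using z L(1) step.hyps by (intro anti) auto
  with z(3) step show ?case by simp
qed simp

lemma sum_powr_le:
  fixes s :: real
  assumes s: "0 < s" "s \<le> 1"
  shows "(\<Sum>m=1..n. real m powr (s - 1)) \<le> real n powr s / s"
proof (cases "n = 0")
  case False
  have "(\<Sum>m=1..n. real m powr (s - 1))
      \<le> real 1 powr (s - 1) + (real n powr s / s - real 1 powr s / s)"
  proof (rule sum_le_antiderivative)
    show "((\<lambda>x. x powr s / s) has_real_derivative x powr (s - 1)) (at x)" if "x \<ge> 1" for x :: real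
      using that s by (auto intro!: derivative_eq_intros simp: field_simps)
    show "y powr (s - 1) \<le> x powr (s - 1)" if "1 \<le> x" "x \<le> y" for x y :: real
      using that s by (intro powr_mono2') auto
  qed (use False in auto)
  also have "\<dots> \<le> real n powr s / s"
    using s by (simp add: field_simps)
  finally show ?thesis .
qed simp

lemma sum_powr_below_le:
  fixes s x :: real
  assumes s: "0 < s" "s \<le> 1" and x: "0 \<le> x"
  shows "(\<Sum>m\<in>{m\<in>{1..N}. real m < x}. real m powr (s - 1)) \<le> x powr s / s"
proof -
  let ?n = "nat \<lfloor>x\<rfloor>"
  have "(\<Sum>m\<in>{m\<in>{1..N}. real m < x}. real m powr (s - 1)) \<le> (\<Sum>m=1..?n. real m powr (s - 1))"
    by (rule sum_mono2) (auto, linarith)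
  also have "\<dots> \<le> real ?n powr s / s" using s by (rule sum_powr_le)
  also have "\<dots> \<le> x powr s / s"
    using s x by (intro divide_right_mono powr_mono2) auto
  finally show ?thesis .
qed

text \<open>The same comparison with a real starting point. Rounding \<open>x\<close> up to an integer only decreases
  both \<open>\<phi> x\<close> and \<open>\<Phi> N - \<Phi> x\<close>.\<close>

lemma sum_above_le:
  fixes \<Phi> \<phi> :: "real \<Rightarrow> real" and x :: real
  assumes deriv: "\<And>x. x \<ge> 1 \<Longrightarrow> (\<Phi> has_real_derivative \<phi> x) (at x)"
    and anti: "\<And>x y. 1 \<le> x \<Longrightarrow> x \<le> y \<Longrightarrow> \<phi> y \<le> \<phi> x"
    and nn: "\<And>x. 1 \<le> x \<Longrightarrow> 0 \<le> \<phi> x"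
    and x: "1 \<le> x" "x \<le> real N"
  shows "(\<Sum>m\<in>{m\<in>{1..N}. x \<le> real m}. \<phi> (real m)) \<le> \<phi> x + (\<Phi> (real N) - \<Phi> x)"
proof -
  let ?L = "nat \<lceil>x\<rceil>"
  have L: "1 \<le> ?L" "?L \<le> N" "x \<le> real ?L" using x by linarith+
  have "{m\<in>{1..N}. x \<le> real m} = {?L..N}" using L x by (auto simp: nat_le_iff ceiling_le_iff)
  hence "(\<Sum>m\<in>{m\<in>{1..N}. x \<le> real m}. \<phi> (real m)) = (\<Sum>m=?L..N. \<phi> (real m))" by simp
  also have "\<dots> \<le> \<phi> (real ?L) + (\<Phi> (real N) - \<Phi> (real ?L))"
    using deriv anti L by (intro sum_le_antiderivative) auto
  also have "\<dots> \<le> \<phi> x + (\<Phi> (real N) - \<Phi> x)"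
  proof -
    have "\<phi> (real ?L) \<le> \<phi> x" using anti x L by auto
    moreover have "\<Phi> x \<le> \<Phi> (real ?L)"
      using L x deriv nn by (intro DERIV_nonneg_imp_nondecreasing[of x "real ?L" \<Phi>]) (auto intro: order_trans)
    ultimately show ?thesis by simp
  qed
  finally show ?thesis .
qed

lemma sum_inverse_above_le:
  fixes x :: real
  assumes x: "1 \<le> x" "x \<le> real N"
  shows "(\<Sum>m\<in>{m\<in>{1..N}. x \<le> real m}. 1 / real m) \<le> 1 + ln (real N / x)"
proof -
  have "(\<Sum>m\<in>{m\<in>{1..N}. x \<le> real m}. 1 / real m) \<le> 1 / x + (ln (real N) - ln x)"
    using x by (intro sum_above_le[where \<phi> = "\<lambda>x. 1 / x"])
      (auto intro!: derivative_eq_intros divide_left_mono simp: field_simps)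
  also have "\<dots> \<le> 1 + ln (real N / x)" using x by (simp add: ln_div)
  finally show ?thesis .
qed

lemma sum_powr_above_le:
  fixes x s :: real
  assumes s: "0 < s" and x: "1 \<le> x" "x \<le> real N"
  shows "(\<Sum>m\<in>{m\<in>{1..N}. x \<le> real m}. real m powr (- 1 - s)) \<le> (1 + 1 / s) * x powr (- s)"
proof -
  have eq: "- 1 - s = - s - 1" by simp
  have "(\<Sum>m\<in>{m\<in>{1..N}. x \<le> real m}. real m powr (- 1 - s))
      \<le> x powr (- 1 - s) + (- (real N powr (- s) / s) - - (x powr (- s) / s))"
  proof (rule sum_above_le)
    show "((\<lambda>x. - (x powr - s / s)) has_real_derivative x powr (- 1 - s)) (at x)" if "x \<ge> 1" for x :: real
      using that s unfolding eq by (auto intro!: derivative_eq_intros)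
    show "y powr (- 1 - s) \<le> x powr (- 1 - s)" if "1 \<le> x" "x \<le> y" for x y :: real
      using that s by (intro powr_mono2') auto
  qed (use x in auto)
  also have "\<dots> \<le> x powr (- s) + x powr (- s) / s"
  proof -
    have "x powr (- 1 - s) \<le> x powr (- s)" "0 \<le> real N powr (- s) / s"
      using x s by (auto intro: powr_mono)
    thus ?thesis by linarith
  qed
  finally show ?thesis by (simp add: algebra_simps)
qed

section \<open>Simple paths\<close>

lemma linked_mono: "linked E p n \<Longrightarrow> k \<le> n \<Longrightarrow> linked E p k"
  by (auto simp: linked_def)

lemma linked_cong: "(\<And>j. j \<le> k \<Longrightarrow> p j = q j) \<Longrightarrow> linked E p k \<longleftrightarrow> linked E q k"
  unfolding linked_def by (intro ball_cong) auto

lemma linked_rev: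
  assumes "sym E" "linked E p n"
  shows "linked E (\<lambda>j. p (n - j)) n"
  unfolding linked_def
proof
  fix j assume j: "j \<in> {1..n}"
  hence "(p (n - j + 1 - 1), p (n - j + 1)) \<in> E"
    using assms(2) unfolding linked_def by (intro bspec[where x = "n - j + 1"]) auto
  moreover have "n - j + 1 = n - (j - 1)" using j by auto
  ultimately show "(p (n - (j - 1)), p (n - j)) \<in> E"
    using assms(1) by (auto dest: symD)
qed

text \<open>The path bound is available for pairwise distinct vertices only. A shortest path is simple, since
  cutting out the loop between two visits of the same vertex would shorten it.\<close>

lemma exists_simple_path:
  fixes p :: "nat \<Rightarrow> nat"
  assumes "p 0 = v" "p n = w" "p ` {0..n} \<subseteq> A" "linked E p n"
  obtains q m where "m \<le> n" "q 0 = v" "q m = w" "q ` {0..m} \<subseteq> A" "linked E q m" "inj_on q {0..m}"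
proof -
  define P where "P m q \<longleftrightarrow> q 0 = v \<and> q m = w \<and> q ` {0..m} \<subseteq> A \<and> linked E q m" for m and q :: "nat \<Rightarrow> nat"
  have ex: "\<exists>q. P n q" using assms unfolding P_def by blast
  define m where "m = (LEAST m. \<exists>q. P m q)"
  have mn: "m \<le> n" unfolding m_def using ex by (rule Least_le)
  have "\<exists>q. P m q" unfolding m_def using ex by (rule LeastI)
  then obtain q where q: "P m q" by blast
  have no: "False" if "i < j" "j \<le> m" "q i = q j" for i j
  proof -
    \<comment> \<open>the path \<open>q\<close> without its loop from position \<open>i\<close> to position \<open>j\<close>\<close>
    define q' where "q' k = (if k \<le> i then q k else q (k + (j - i)))" for k
    have "P (m - (j - i)) q'"
    proof -
      have "q' 0 = v" using q by (auto simp: P_def q'_def)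
      moreover have "q' (m - (j - i)) = w"
      proof (cases "m - (j - i) \<le> i")
        case True
        hence "j = m" "m - (j - i) = i" using that by auto
        thus ?thesis using q that by (auto simp: P_def q'_def)
      next
        case False
        thus ?thesis using q that by (auto simp: P_def q'_def)
      qed
      moreover have "q' ` {0..m - (j - i)} \<subseteq> A"
      proof
        fix x assume "x \<in> q' ` {0..m - (j - i)}"
        then obtain k where k: "k \<le> m - (j - i)" "x = q' k" by auto
        have "x \<in> q ` {0..m}"
          using k that by (auto simp: q'_def split: if_splits)
        thus "x \<in> A" using q by (auto simp: P_def)
      qed
      moreover have "linked E q' (m - (j - i))"
        unfolding linked_def
      proof
        fix k assume k: "k \<in> {1..m - (j - i)}"
        have L: "(q (k - 1), q k) \<in> E" if "1 \<le> k" "k \<le> m" for k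
          using q that by (auto simp: P_def linked_def)
        consider "k \<le> i" | "k = i + 1" | "k > i + 1" by linarith
        thus "(q' (k - 1), q' k) \<in> E"
        proof cases
          case 1
          thus ?thesis using L[of k] k that by (auto simp: q'_def)
        next
          case 2
          thus ?thesis using L[of "j + 1"] k that by (auto simp: q'_def)
        next
          case 3
          thus ?thesis using L[of "k + (j - i)"] k that by (auto simp: q'_def)
        qed
      qed
      ultimately show ?thesis by (simp add: P_def)
    qed
    hence "m \<le> m - (j - i)" unfolding m_def by (intro Least_le) blast
    thus False using that by auto
  qed
  have "inj_on q {0..m}"
  proof (rule linorder_inj_onI')
    fix i j assume "i \<in> {0..m}" "j \<in> {0..m}" "i < j"
    thus "q i \<noteq> q j" using no[of i j] by auto
  qed
  with q mn that show thesis unfolding P_def by blast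
qed

lemma graph_dist_le_imp_path:
  assumes "graph_dist N E v w \<le> enat m"
  obtains p n where "n \<le> m" "p 0 = v" "p n = w" "p ` {0..n} \<subseteq> {1..N}" "linked E p n" "inj_on p {0..n}"
proof -
  have "graph_dist N E v w < enat (Suc m)" using assms by (simp add: order_le_less_trans)
  then obtain n p where p: "n < Suc m" "p 0 = v" "p n = w" "p ` {0..n} \<subseteq> {1..N}" "linked E p n"
    unfolding graph_dist_def Inf_less_iff by auto
  from exists_simple_path[OF p(2-5)] obtain q n' where
    "n' \<le> n" "q 0 = v" "q n' = w" "q ` {0..n'} \<subseteq> {1..N}" "linked E q n'" "inj_on q {0..n'}" by blast
  with p(1) show thesis by (intro that[of n' q]) auto
qed

section \<open>Truncation of paths\<close>

definition truncated_paths :: "nat \<Rightarrow> (nat \<Rightarrow> real) \<Rightarrow> nat \<Rightarrow> nat \<Rightarrow> nat \<Rightarrow> (nat \<Rightarrow> nat) set" where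
  "truncated_paths N \<tau> k v u =
     {p \<in> {0..k} \<rightarrow>\<^sub>E {1..N}. p 0 = v \<and> p k = u \<and> (\<forall>j<k. \<tau> j \<le> real (p j))}"

text \<open>The middle vertex \<open>p a\<close> is free: it becomes the end of both halves, where
  \<open>truncated_paths\<close> imposes no threshold either.\<close>

definition two_sided_paths :: "nat \<Rightarrow> (nat \<Rightarrow> real) \<Rightarrow> nat \<Rightarrow> nat \<Rightarrow> nat \<Rightarrow> nat \<Rightarrow> (nat \<Rightarrow> nat) set" where
  "two_sided_paths N \<tau> a b v w =
     {p \<in> {0..a+b} \<rightarrow>\<^sub>E {1..N}. p 0 = v \<and> p (a + b) = w \<and>
        (\<forall>j<a. \<tau> j \<le> real (p j)) \<and> (\<forall>j<b. \<tau> j \<le> real (p (a + b - j)))}"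

lemma finite_truncated_paths [simp, intro]: "finite (truncated_paths N \<tau> k v u)"
  unfolding truncated_paths_def by (rule finite_subset[OF _ finite_PiE[of "{0..k}" "\<lambda>_. {1..N}"]]) auto

lemma finite_two_sided_paths [simp, intro]: "finite (two_sided_paths N \<tau> a b v u)"
  unfolding two_sided_paths_def by (rule finite_subset[OF _ finite_PiE[of "{0..a+b}" "\<lambda>_. {1..N}"]]) auto

text \<open>Every short simple path between two vertices not below \<open>\<tau> 0\<close> is seen by one of the three families that
  the first moment bound sums over. If, from one of the two ends, some vertex in the corresponding half
  lies below its threshold, then the path up to the first such vertex is a truncated path; the third
  family consists of the paths without such a vertex.\<close>

lemma simple_path_cases:
  fixes \<tau> :: "nat \<Rightarrow> real"
  assumes E: "sym E" and p: "p ` {0..n} \<subseteq> {1..N}" "p 0 = v" "p n = w" "linked E p n" "inj_on p {0..n}"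
    and n: "n \<le> 2 * h" and vw: "\<tau> 0 \<le> real v" "\<tau> 0 \<le> real w"
  obtains (left) k u q where "k \<in> {1..h}" "u \<in> {1..N}" "real u < \<tau> k" "q \<in> truncated_paths N \<tau> k v u"
      "linked E q k" "inj_on q {0..k}"
    | (right) k u q where "k \<in> {1..h}" "u \<in> {1..N}" "real u < \<tau> k" "q \<in> truncated_paths N \<tau> k w u"
      "linked E q k" "inj_on q {0..k}"
    | (good) q where "q \<in> two_sided_paths N \<tau> (n div 2) (n - n div 2) v w"
      "linked E q n" "inj_on q {0..n}"
proof -
  have first_drop: "\<exists>k u q. k \<in> {1..h} \<and> u \<in> {1..N} \<and> real u < \<tau> k \<and> q \<in> truncated_paths N \<tau> k x u \<and>
      linked E q k \<and> inj_on q {0..k}"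
    if r: "r ` {0..n} \<subseteq> {1..N}" "r 0 = x" "linked E r n" "inj_on r {0..n}" "\<tau> 0 \<le> real x"
      and j: "j \<le> h" "j \<le> n" "real (r j) < \<tau> j" for r x j
  proof -
    \<comment> \<open>the prefix up to the first vertex below its threshold\<close>
    define k where "k = (LEAST k. real (r k) < \<tau> k)"
    have k: "real (r k) < \<tau> k" unfolding k_def using j(3) by (rule LeastI)
    have kj: "k \<le> j" unfolding k_def using j(3) by (rule Least_le)
    have below: "\<tau> i \<le> real (r i)" if "i < k" for i
      using that not_less_Least unfolding k_def by (metis not_le_imp_less)
    have "k \<noteq> 0" using k r by (metis not_less)
    moreover have "r k \<in> {1..N}" using kj j by (intro set_mp[OF r(1)] imageI) auto
    moreover have "restrict r {0..k} \<in> truncated_paths N \<tau> k x (r k)"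
      using r kj j below \<open>k \<noteq> 0\<close> by (auto simp: truncated_paths_def)
    moreover have "linked E (restrict r {0..k}) k"
      using linked_mono[OF r(3), of k] kj j by (subst linked_cong[of k _ r]) auto
    moreover have "inj_on (restrict r {0..k}) {0..k}"
      using r(4) kj j by (auto intro: inj_on_subset)
    ultimately show ?thesis using k kj j
      by (intro exI[of _ k] exI[of _ "r k"] exI[of _ "restrict r {0..k}"]) auto
  qed
  define a b where "a = n div 2" and "b = n - n div 2"
  have ab: "a + b = n" "a \<le> h" "b \<le> h" using n unfolding a_def b_def by auto
  define q where "q = (\<lambda>j. p (n - j))"
  consider (L) j where "j \<le> a" "real (p j) < \<tau> j" | (R) j where "j \<le> b" "real (q j) < \<tau> j"
    | (G) "\<forall>j\<le>a. \<tau> j \<le> real (p j)" "\<forall>j\<le>b. \<tau> j \<le> real (q j)"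
    by (meson not_le_imp_less)
  thus thesis
  proof cases
    case L
    thus thesis using first_drop[of p v j] left p vw ab by auto
  next
    case R
    have "q ` {0..n} \<subseteq> {1..N}" using p(1) by (auto simp: q_def)
    moreover have "inj_on q {0..n}"
      using p(5) unfolding q_def inj_on_def by (metis atLeastAtMost_iff diff_diff_cancel diff_le_self le0)
    ultimately show thesis using R first_drop[of q w j] right p vw ab linked_rev[OF E p(4)]
      by (auto simp: q_def)
  next
    case G
    show thesis
    proof (rule good)
      show "restrict p {0..n} \<in> two_sided_paths N \<tau> (n div 2) (n - n div 2) v w"
        unfolding a_def[symmetric] b_def[symmetric] two_sided_paths_def ab
        using p G ab by (auto simp: q_def)
      show "linked E (restrict p {0..n}) n" using p(4) by (subst linked_cong[of n _ p]) auto
      show "inj_on (restrict p {0..n}) {0..n}" using p(5) by simp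
    qed
  qed
qed

section \<open>Averaging over uniform endpoints\<close>

lemma graph_event_measurable:
  assumes "G \<in> measurable M (count_space (graphs_on N))"
  shows "{\<omega> \<in> space M. R (G \<omega>)} \<in> sets M"
proof -
  have "{\<omega> \<in> space M. R (G \<omega>)} = G -` {E \<in> graphs_on N. R E} \<inter> space M"
    using measurable_space[OF assms] by auto
  also have "\<dots> \<in> sets M" by (rule measurable_sets[OF assms]) auto
  finally show ?thesis .
qed

text \<open>Independence and uniformity enter only here: the probability of an event for the random triple is the
  average over deterministic endpoints. The joint law is evaluated on the rectangles with
  fixed \<open>(v, w)\<close>, of which there are finitely many.\<close>

lemma uniform_vertices_average:
  assumes uv: "uniform_vertices M G V W" and nm: "network_model M G" and N: "1 \<le> N"
  shows "{\<omega> \<in> space (M N). Q (G N \<omega>) (V N \<omega>) (W N \<omega>)} \<in> sets (M N)" (is "?ev \<in> _")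
    and "measure (M N) {\<omega> \<in> space (M N). Q (G N \<omega>) (V N \<omega>) (W N \<omega>)} =
      (\<Sum>v=1..N. \<Sum>w=1..N. measure (M N) {\<omega> \<in> space (M N). Q (G N \<omega>) v w}) / (real N)\<^sup>2"
proof -
  interpret prob_space "M N" using nm N by (auto simp: network_model_def)
  let ?CG = "count_space (graphs_on N)" and ?CN = "count_space {1..N}" and ?U = "uniform_count_measure {1..N}"
  let ?f = "\<lambda>\<omega>. (G N \<omega>, V N \<omega>, W N \<omega>)" and ?D = "count_space (graphs_on N) \<Otimes>\<^sub>M (count_space {1..N} \<Otimes>\<^sub>M count_space {1..N})"
  have mG: "G N \<in> measurable (M N) ?CG" using nm N by (auto simp: network_model_def)
  have mV: "V N \<in> measurable (M N) ?CN" and mW: "W N \<in> measurable (M N) ?CN"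
    and law: "distr (M N) ?D ?f = distr (M N) ?CG (G N) \<Otimes>\<^sub>M (?U \<Otimes>\<^sub>M ?U)"
    using uv N by (auto simp: uniform_vertices_def)
  have mf: "?f \<in> measurable (M N) ?D" using mG mV mW by auto
  interpret U: prob_space ?U using N by (intro prob_space_uniform_count_measure) auto
  interpret UU: pair_prob_space ?U ?U ..
  define S where "S = (\<lambda>(v, w). {\<omega> \<in> space (M N). Q (G N \<omega>) v w \<and> V N \<omega> = v \<and> W N \<omega> = w})"
  have one: "S (v, w) \<in> sets (M N)"
    "measure (M N) (S (v, w)) = measure (M N) {\<omega> \<in> space (M N). Q (G N \<omega>) v w} / (real N)\<^sup>2"
    if vw: "v \<in> {1..N}" "w \<in> {1..N}" for v w
  proof -
    let ?A = "{E \<in> graphs_on N. Q E v w}" and ?B = "{v} \<times> {w}"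
    have pre: "S (v, w) = ?f -` (?A \<times> ?B) \<inter> space (M N)"
      using measurable_space[OF mG] by (auto simp: S_def)
    have B: "?B \<in> sets (?CN \<Otimes>\<^sub>M ?CN)" "?A \<in> sets ?CG" using vw by (intro pair_measureI) auto
    show "S (v, w) \<in> sets (M N)" unfolding pre using mf B by (intro measurable_sets[OF mf]) auto
    have card: "emeasure ?U {x} = ennreal (1 / real N)" if "x \<in> {1..N}" for x
      using that N by (subst emeasure_uniform_count_measure) auto
    have "emeasure (M N) (S (v, w)) = emeasure (distr (M N) ?D ?f) (?A \<times> ?B)"
      unfolding pre using mf B by (intro emeasure_distr[symmetric]) auto
    also have "\<dots> = emeasure (distr (M N) ?CG (G N)) ?A * emeasure (?U \<Otimes>\<^sub>M ?U) ?B"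
      unfolding law using vw by (intro UU.emeasure_pair_measure_Times pair_measureI) (auto simp: sets_uniform_count_measure)
    also have "emeasure (?U \<Otimes>\<^sub>M ?U) ?B = ennreal (1 / real N) * ennreal (1 / real N)"
      using vw card by (subst U.emeasure_pair_measure_Times) (auto simp: sets_uniform_count_measure)
    also have "emeasure (distr (M N) ?CG (G N)) ?A = emeasure (M N) {\<omega> \<in> space (M N). Q (G N \<omega>) v w}"
      using measurable_space[OF mG] by (subst emeasure_distr[OF mG]) (auto intro!: arg_cong[where f = "emeasure (M N)"])
    finally have "emeasure (M N) (S (v, w)) =
        ennreal (measure (M N) {\<omega> \<in> space (M N). Q (G N \<omega>) v w} * (1 / real N * (1 / real N)))"
      by (simp add: emeasure_eq_measure flip: ennreal_mult)
    hence "measure (M N) (S (v, w)) = measure (M N) {\<omega> \<in> space (M N). Q (G N \<omega>) v w} * (1 / real N * (1 / real N))"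
      by (subst (asm) emeasure_eq_measure) (simp add: ennreal_inj)
    thus "measure (M N) (S (v, w)) = measure (M N) {\<omega> \<in> space (M N). Q (G N \<omega>) v w} / (real N)\<^sup>2"
      by (simp add: power2_eq_square)
  qed
  have ev: "?ev = (\<Union>x\<in>{1..N}\<times>{1..N}. S x)"
  proof (intro set_eqI iffI)
    fix \<omega> assume "\<omega> \<in> ?ev"
    thus "\<omega> \<in> (\<Union>x\<in>{1..N}\<times>{1..N}. S x)"
      using measurable_space[OF mV, of \<omega>] measurable_space[OF mW, of \<omega>]
      by (intro UN_I[of "(V N \<omega>, W N \<omega>)"]) (auto simp: S_def)
  qed (auto simp: S_def)
  show "?ev \<in> sets (M N)" unfolding ev using one(1) by (intro sets.finite_UN) auto
  have "measure (M N) ?ev = (\<Sum>x\<in>{1..N}\<times>{1..N}. measure (M N) (S x))"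
    unfolding ev using one(1)
    by (intro finite_measure_finite_Union) (auto simp: disjoint_family_on_def S_def)
  also have "\<dots> = (\<Sum>v=1..N. \<Sum>w=1..N. measure (M N) (S (v, w)))"
    by (simp add: sum.cartesian_product)
  also have "\<dots> = (\<Sum>v=1..N. \<Sum>w=1..N. measure (M N) {\<omega> \<in> space (M N). Q (G N \<omega>) v w}) / (real N)\<^sup>2"
    using one(2) by (simp add: sum_divide_distrib)
  finally show "measure (M N) ?ev = (\<Sum>v=1..N. \<Sum>w=1..N. measure (M N) {\<omega> \<in> space (M N). Q (G N \<omega>) v w}) / (real N)\<^sup>2" .
qed

section \<open>Total weight of truncated paths\<close>

text \<open>The constants of assumption \<open>PA\<close>. That \<open>\<kappa>\<close> is at least 1 is no restriction, as the bounds
  in \<open>PA\<close> remain valid if the constant is replaced by the maximum of 1 and its absolute value.\<close>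

locale pa_weights =
  fixes \<kappa> \<gamma> :: real
  assumes kappa_ge_1: "1 \<le> \<kappa>" and gamma: "1 / 2 < \<gamma>" "\<gamma> < 1"
begin

definition edge_weight :: "nat \<Rightarrow> nat \<Rightarrow> real" where
  "edge_weight m n = \<kappa> * real (min m n) powr (- \<gamma>) * real (max m n) powr (\<gamma> - 1)"

definition path_weight :: "(nat \<Rightarrow> nat) \<Rightarrow> nat \<Rightarrow> real" where
  "path_weight p k = (\<Prod>j=1..k. edge_weight (p (j - 1)) (p j))"

definition path_sum :: "nat \<Rightarrow> (nat \<Rightarrow> real) \<Rightarrow> nat \<Rightarrow> nat \<Rightarrow> nat \<Rightarrow> real" where
  "path_sum N \<tau> k v u = (\<Sum>p\<in>truncated_paths N \<tau> k v u. path_weight p k)"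

lemma edge_weight_nonneg: "0 \<le> edge_weight m n"
  using kappa_ge_1 by (auto simp: edge_weight_def)

lemma edge_weight_commute: "edge_weight m n = edge_weight n m"
  by (simp add: edge_weight_def min.commute max.commute)

lemma path_weight_nonneg: "0 \<le> path_weight p k"
  by (auto simp: path_weight_def intro!: prod_nonneg edge_weight_nonneg)

lemma path_sum_nonneg: "0 \<le> path_sum N \<tau> k v u"
  by (auto simp: path_sum_def intro!: sum_nonneg path_weight_nonneg)

lemma path_weight_cong: "(\<And>j. j \<le> k \<Longrightarrow> p j = q j) \<Longrightarrow> path_weight p k = path_weight q k"
  unfolding path_weight_def by (intro prod.cong) auto

lemma path_weight_0 [simp]: "path_weight p 0 = 1"
  by (simp add: path_weight_def)

lemma path_weight_Suc: "path_weight p (Suc k) = path_weight p k * edge_weight (p k) (p (Suc k))"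
  by (simp add: path_weight_def)

lemma path_sum_0: "path_sum N \<tau> 0 v u \<le> (if u = v then 1 else 0)"
proof -
  have "truncated_paths N \<tau> 0 v u \<subseteq> (if u = v then {\<lambda>j\<in>{0}. v} else {})"
    by (auto simp: truncated_paths_def PiE_def extensional_def)
  hence "path_sum N \<tau> 0 v u \<le> (\<Sum>p\<in>(if u = v then {\<lambda>j\<in>{0::nat}. v} else {}). path_weight p 0)"
    unfolding path_sum_def by (intro sum_mono2 path_weight_nonneg) auto
  thus ?thesis by (auto split: if_splits)
qed

text \<open>A truncated path of length \<open>k + 1\<close> is determined by its last but one vertex \<open>m\<close> and by the
  truncated path of length \<open>k\<close> that leads to \<open>m\<close>.\<close>

lemma path_sum_Suc:
  "path_sum N \<tau> (Suc k) v u \<le>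
     (\<Sum>m\<in>{m\<in>{1..N}. \<tau> k \<le> real m}. path_sum N \<tau> k v m * edge_weight m u)"
proof -
  let ?S = "truncated_paths N \<tau> (Suc k) v u" and ?M = "{m\<in>{1..N}. \<tau> k \<le> real m}"
  let ?T = "SIGMA m:?M. truncated_paths N \<tau> k v m"
  \<comment> \<open>remembers the last but one vertex and the path up to it\<close>
  let ?g = "\<lambda>p. (p k, restrict p {0..k})" and ?f = "\<lambda>(m, q). path_weight q k * edge_weight m u"
  have inj: "inj_on ?g ?S"
  proof (rule inj_onI)
    fix p q assume pq: "p \<in> ?S" "q \<in> ?S" "?g p = ?g q"
    have "p j = q j" if "j \<in> {0..Suc k}" for j
    proof (cases "j = Suc k")
      case True thus ?thesis using pq by (auto simp: truncated_paths_def)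
    next
      case False
      hence "j \<in> {0..k}" using that by auto
      thus ?thesis using pq(3) by (metis prod.inject restrict_apply)
    qed
    thus "p = q" using pq by (intro PiE_ext[of p "{0..Suc k}" "\<lambda>_. {1..N}"]) (auto simp: truncated_paths_def)
  qed
  have img: "?g ` ?S \<subseteq> ?T"
    by (auto simp: truncated_paths_def PiE_def Pi_def)
  have "path_sum N \<tau> (Suc k) v u = (\<Sum>p\<in>?S. ?f (?g p))"
    unfolding path_sum_def
  proof (rule sum.cong)
    fix p assume p: "p \<in> ?S"
    have "path_weight (restrict p {0..k}) k = path_weight p k" by (intro path_weight_cong) auto
    thus "path_weight p (Suc k) = ?f (?g p)"
      using p by (simp add: path_weight_Suc truncated_paths_def)
  qed simp
  also have "\<dots> = sum ?f (?g ` ?S)" using inj by (simp add: sum.reindex)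
  also have "\<dots> \<le> sum ?f ?T"
    using img by (intro sum_mono2) (auto intro!: mult_nonneg_nonneg path_weight_nonneg edge_weight_nonneg)
  also have "\<dots> = (\<Sum>m\<in>?M. path_sum N \<tau> k v m * edge_weight m u)"
    by (subst sum.Sigma[symmetric]) (auto simp: path_sum_def sum_distrib_right)
  finally show ?thesis .
qed

lemma path_weight_split:
  "path_weight p (a + b) = path_weight p a * path_weight (\<lambda>j. p (a + b - j)) b"
proof -
  have "path_weight p (a + b) = path_weight p a * (\<Prod>j=a+1..a+b. edge_weight (p (j - 1)) (p j))"
    unfolding path_weight_def by (subst prod.ub_add_nat) auto
  also have "(\<Prod>j=a+1..a+b. edge_weight (p (j - 1)) (p j)) = path_weight (\<lambda>j. p (a + b - j)) b"
    unfolding path_weight_def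
  proof (rule prod.reindex_bij_witness[of _ "\<lambda>j. a + b + 1 - j" "\<lambda>j. a + b + 1 - j"])
    fix j assume j: "j \<in> {a + 1..a + b}"
    hence "a + b - (a + b + 1 - j - 1) = j" "a + b - (a + b + 1 - j) = j - 1" by auto
    thus "edge_weight (p (a + b - (a + b + 1 - j - 1))) (p (a + b - (a + b + 1 - j)))
        = edge_weight (p (j - 1)) (p j)"
      by (simp add: edge_weight_commute)
  qed auto
  finally show ?thesis .
qed

text \<open>Cutting at the vertex \<open>u\<close> in position \<open>a\<close> and reversing the second half turns a two-sided path into two
  truncated paths with the common end \<open>u\<close>.\<close>

lemma two_sided_sum_le:
  "(\<Sum>p\<in>two_sided_paths N \<tau> a b v w. path_weight p (a + b))
     \<le> (\<Sum>u=1..N. path_sum N \<tau> a v u * path_sum N \<tau> b w u)"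
proof -
  let ?S = "two_sided_paths N \<tau> a b v w"
  let ?T = "SIGMA u:{1..N}. truncated_paths N \<tau> a v u \<times> truncated_paths N \<tau> b w u"
  let ?g = "\<lambda>p. (p a, restrict p {0..a}, \<lambda>j\<in>{0..b}. p (a + b - j))"
  let ?f = "\<lambda>(u, q, q'). path_weight q a * path_weight q' b"
  have inj: "inj_on ?g ?S"
  proof (rule inj_onI)
    fix p q assume pq: "p \<in> ?S" "q \<in> ?S" "?g p = ?g q"
    have e1: "restrict p {0..a} = restrict q {0..a}"
      and e2: "(\<lambda>j\<in>{0..b}. p (a + b - j)) = (\<lambda>j\<in>{0..b}. q (a + b - j))" using pq(3) by auto
    have "p j = q j" if "j \<in> {0..a + b}" for j
    proof (cases "j \<le> a")
      case True
      thus ?thesis using fun_cong[OF e1, of j] by auto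
    next
      case False
      hence "a + b - j \<le> b" "a + b - (a + b - j) = j" using that by auto
      thus ?thesis using fun_cong[OF e2, of "a + b - j"] by simp
    qed
    thus "p = q" using pq by (intro PiE_ext[of p "{0..a + b}" "\<lambda>_. {1..N}"]) (auto simp: two_sided_paths_def)
  qed
  have img: "?g ` ?S \<subseteq> ?T"
    by (auto simp: truncated_paths_def two_sided_paths_def PiE_def Pi_def)
  have "(\<Sum>p\<in>?S. path_weight p (a + b)) = (\<Sum>p\<in>?S. ?f (?g p))"
  proof (rule sum.cong)
    fix p assume p: "p \<in> ?S"
    have "path_weight (restrict p {0..a}) a = path_weight p a" by (intro path_weight_cong) auto
    moreover have "path_weight (\<lambda>j\<in>{0..b}. p (a + b - j)) b = path_weight (\<lambda>j. p (a + b - j)) b"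
      by (intro path_weight_cong) auto
    ultimately show "path_weight p (a + b) = ?f (?g p)"
      by (simp add: path_weight_split)
  qed simp
  also have "\<dots> = sum ?f (?g ` ?S)" using inj by (simp add: sum.reindex)
  also have "\<dots> \<le> sum ?f ?T"
    using img by (intro sum_mono2) (auto intro!: mult_nonneg_nonneg path_weight_nonneg finite_SigmaI)
  also have "\<dots> = (\<Sum>u=1..N. path_sum N \<tau> a v u * path_sum N \<tau> b w u)"
    by (subst sum.Sigma[symmetric]) (auto simp: path_sum_def sum_product sum.cartesian_product)
  finally show ?thesis .
qed

section \<open>The recursion for path sums\<close>

text \<open>The factor \<open>1 + 1 / (2 * \<gamma> - 1)\<close> dominates the constants of the three sums that occur in one
  step of the recursion.\<close>

definition rec_const :: real where
  "rec_const = \<kappa> * (1 + 1 / (2 * \<gamma> - 1))"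

lemma rec_const_ge: "1 \<le> rec_const" "\<kappa> \<le> rec_const"
proof -
  have "\<kappa> * 1 \<le> rec_const"
    unfolding rec_const_def using kappa_ge_1 gamma by (intro mult_left_mono) auto
  thus "1 \<le> rec_const" "\<kappa> \<le> rec_const" using kappa_ge_1 by auto
qed

text \<open>Uniformly in \<open>m \<ge> t\<close> the step to a younger vertex \<open>n\<close> can occur only for \<open>n > t\<close>. This is why the
  second term is absent below the threshold, where it would spoil the estimate of
  the paths that drop below it.\<close>

lemma edge_weight_le:
  assumes "t \<le> real m"
  shows "edge_weight m n \<le> \<kappa> * (real m powr (\<gamma> - 1) * real n powr (- \<gamma>))
     + (if t < real n then 1 else 0) * (\<kappa> * (real m powr (- \<gamma>) * real n powr (\<gamma> - 1)))"
proof (cases "m < n")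
  case True
  have "edge_weight m n = \<kappa> * (real m powr (- \<gamma>) * real n powr (\<gamma> - 1))"
    using True by (simp add: edge_weight_def min_def max_def)
  moreover have "0 \<le> \<kappa> * (real m powr (\<gamma> - 1) * real n powr (- \<gamma>))"
    using kappa_ge_1 by simp
  ultimately show ?thesis using True assms by simp
next
  case False
  have "edge_weight m n = \<kappa> * (real m powr (\<gamma> - 1) * real n powr (- \<gamma>))"
    using False by (simp add: edge_weight_def min_def max_def)
  thus ?thesis using kappa_ge_1 by simp
qed

text \<open>One step of the recursion. Multiplying the two terms of the bound for \<open>f\<close> with the two terms of the
  edge weight yields the powers \<open>1 / m\<close> (twice), \<open>m\<^sup>2\<^sup>\<gamma>\<^sup>-\<^sup>2\<close> and \<open>m\<^sup>-\<^sup>2\<^sup>\<gamma>\<close>. As \<open>\<gamma> > 1 / 2\<close>, the sum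
  of the second is governed by \<open>m\<close> near \<open>N\<close> and that of the third by \<open>m\<close> near the threshold.\<close>

lemma sum_edge_weight_le:
  assumes t: "1 \<le> t" "t \<le> real N" and \<alpha>\<beta>: "0 \<le> \<alpha>" "0 \<le> \<beta>"
    and f: "\<And>m. m \<in> {1..N} \<Longrightarrow> 0 \<le> f m \<and> f m \<le> \<alpha> * real m powr (- \<gamma>) + \<beta> * real m powr (\<gamma> - 1)"
  shows "(\<Sum>m\<in>{m\<in>{1..N}. t \<le> real m}. f m * edge_weight m u)
     \<le> rec_const * (\<alpha> * (1 + ln (real N / t)) + \<beta> * real N powr (2 * \<gamma> - 1)) * real u powr (- \<gamma>)
       + (if t < real u then
            rec_const * (\<alpha> * t powr (- (2 * \<gamma> - 1)) + \<beta> * (1 + ln (real N / t))) * real u powr (\<gamma> - 1)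
          else 0)"
proof -
  define s where "s = 2 * \<gamma> - 1"
  define I where "I = (if t < real u then 1 else 0 :: real)"
  define X where "X = 1 + ln (real N / t)"
  have s: "0 < s" "s \<le> 1" using gamma by (auto simp: s_def)
  let ?M = "{m\<in>{1..N}. t \<le> real m}"
  have I: "0 \<le> I" by (simp add: I_def)
  have k: "0 \<le> \<kappa>" using kappa_ge_1 by simp
  have X: "1 \<le> X" using t by (simp add: X_def)
  have S1: "(\<Sum>m\<in>?M. 1 / real m) \<le> X"
    unfolding X_def using t by (rule sum_inverse_above_le)
  have S2: "(\<Sum>m\<in>?M. real m powr (s - 1)) \<le> real N powr s / s"
  proof -
    have "(\<Sum>m\<in>?M. real m powr (s - 1)) \<le> (\<Sum>m=1..N. real m powr (s - 1))"
      by (intro sum_mono2) auto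
    also have "\<dots> \<le> real N powr s / s" using s by (rule sum_powr_le)
    finally show ?thesis .
  qed
  have S3: "(\<Sum>m\<in>?M. real m powr (- 1 - s)) \<le> (1 + 1 / s) * t powr (- s)"
    using s t by (intro sum_powr_above_le) auto
  have "(\<Sum>m\<in>?M. f m * edge_weight m u) \<le>
      (\<Sum>m\<in>?M. \<kappa> * real u powr (- \<gamma>) * (\<alpha> * (1 / real m) + \<beta> * real m powr (s - 1))
        + I * \<kappa> * real u powr (\<gamma> - 1) * (\<alpha> * real m powr (- 1 - s) + \<beta> * (1 / real m)))"
  proof (rule sum_mono)
    fix m assume m: "m \<in> ?M"
    hence m1: "real m \<ge> 1" by auto
    have e1: "real m powr (- \<gamma>) * real m powr (\<gamma> - 1) = 1 / real m"
      using m1 powr_minus_divide[of "real m" 1] by (simp add: powr_add[symmetric])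
    have e2: "real m powr (\<gamma> - 1) * real m powr (\<gamma> - 1) = real m powr (s - 1)"
      by (simp add: powr_add[symmetric] s_def)
    have e3: "real m powr (- \<gamma>) * real m powr (- \<gamma>) = real m powr (- 1 - s)"
      by (simp add: powr_add[symmetric] s_def)
    have "f m * edge_weight m u \<le> (\<alpha> * real m powr (- \<gamma>) + \<beta> * real m powr (\<gamma> - 1)) *
       (\<kappa> * (real m powr (\<gamma> - 1) * real u powr (- \<gamma>)) + I * (\<kappa> * (real m powr (- \<gamma>) * real u powr (\<gamma> - 1))))"
      unfolding I_def
      using m f[of m] \<alpha>\<beta> by (intro mult_mono edge_weight_le edge_weight_nonneg) auto
    also have "\<dots> = \<kappa> * real u powr (- \<gamma>) *
          (\<alpha> * (real m powr (- \<gamma>) * real m powr (\<gamma> - 1)) + \<beta> * (real m powr (\<gamma> - 1) * real m powr (\<gamma> - 1)))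
        + I * \<kappa> * real u powr (\<gamma> - 1) *
          (\<alpha> * (real m powr (- \<gamma>) * real m powr (- \<gamma>)) + \<beta> * (real m powr (- \<gamma>) * real m powr (\<gamma> - 1)))"
      by (simp add: algebra_simps)
    finally show "f m * edge_weight m u \<le> \<kappa> * real u powr (- \<gamma>) * (\<alpha> * (1 / real m) + \<beta> * real m powr (s - 1))
        + I * \<kappa> * real u powr (\<gamma> - 1) * (\<alpha> * real m powr (- 1 - s) + \<beta> * (1 / real m))"
      unfolding e1 e2 e3 .
  qed
  also have "\<dots> = \<kappa> * real u powr (- \<gamma>) * (\<alpha> * (\<Sum>m\<in>?M. 1 / real m) + \<beta> * (\<Sum>m\<in>?M. real m powr (s - 1)))
        + I * \<kappa> * real u powr (\<gamma> - 1) * (\<alpha> * (\<Sum>m\<in>?M. real m powr (- 1 - s)) + \<beta> * (\<Sum>m\<in>?M. 1 / real m))"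
    by (simp only: sum.distrib sum_distrib_left[symmetric])
  also have "\<dots> \<le> \<kappa> * real u powr (- \<gamma>) * (\<alpha> * X + \<beta> * (real N powr s / s))
        + I * \<kappa> * real u powr (\<gamma> - 1) * (\<alpha> * ((1 + 1 / s) * t powr (- s)) + \<beta> * X)"
    using S1 S2 S3 \<alpha>\<beta> k I by (intro add_mono mult_left_mono) auto
  also have "\<dots> \<le> \<kappa> * real u powr (- \<gamma>) * ((1 + 1 / s) * (\<alpha> * X + \<beta> * real N powr s))
        + I * \<kappa> * real u powr (\<gamma> - 1) * ((1 + 1 / s) * (\<alpha> * t powr (- s) + \<beta> * X))"
  proof -
    have "0 \<le> \<alpha> * X / s" "0 \<le> \<beta> * X / s" "0 \<le> \<beta> * real N powr s"
      using \<alpha>\<beta> X s by auto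
    hence "\<alpha> * X + \<beta> * (real N powr s / s) \<le> (1 + 1 / s) * (\<alpha> * X + \<beta> * real N powr s)"
      "\<alpha> * ((1 + 1 / s) * t powr (- s)) + \<beta> * X \<le> (1 + 1 / s) * (\<alpha> * t powr (- s) + \<beta> * X)"
      by (auto simp: algebra_simps)
    thus ?thesis using k I by (intro add_mono mult_left_mono) auto
  qed
  also have "\<dots> = rec_const * (\<alpha> * X + \<beta> * real N powr s) * real u powr (- \<gamma>)
       + I * (rec_const * (\<alpha> * t powr (- s) + \<beta> * X) * real u powr (\<gamma> - 1))"
    by (simp add: rec_const_def s_def algebra_simps)
  finally show ?thesis unfolding I_def X_def s_def by (auto split: if_splits)
qed

text \<open>The two-term bound for path sums, for any thresholds and any coefficients that satisfy the recursive
  inequalities. Its right-hand side does not depend on the starting vertex \<open>v\<close>, because no truncated path of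
  positive length starts below \<open>\<tau> 0\<close>.\<close>

lemma path_sum_le:
  fixes \<alpha> \<beta> \<tau> :: "nat \<Rightarrow> real"
  assumes nonneg: "\<And>k. 0 \<le> \<alpha> k" "\<And>k. 0 \<le> \<beta> k"
    and \<tau>: "\<And>k. k \<le> h \<Longrightarrow> 1 \<le> \<tau> k \<and> \<tau> k \<le> real N"
    and base: "\<kappa> * \<tau> 0 powr (\<gamma> - 1) \<le> \<alpha> 1" "\<kappa> * \<tau> 0 powr (- \<gamma>) \<le> \<beta> 1"
    and \<alpha>_step: "\<And>k. 1 \<le> k \<Longrightarrow> k < h \<Longrightarrow>
        rec_const * (\<alpha> k * (1 + ln (real N / \<tau> k)) + \<beta> k * real N powr (2 * \<gamma> - 1)) \<le> \<alpha> (Suc k)"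
    and \<beta>_step: "\<And>k. 1 \<le> k \<Longrightarrow> k < h \<Longrightarrow>
        rec_const * (\<alpha> k * \<tau> k powr (- (2 * \<gamma> - 1)) + \<beta> k * (1 + ln (real N / \<tau> k))) \<le> \<beta> (Suc k)"
    and k: "1 \<le> k" "k \<le> h" and u: "u \<in> {1..N}"
  shows "path_sum N \<tau> k v u \<le>
     \<alpha> k * real u powr (- \<gamma>) + (if \<tau> (k - 1) < real u then \<beta> k * real u powr (\<gamma> - 1) else 0)"
  using k u
proof (induction k arbitrary: u rule: dec_induct)
  case base
  let ?M = "{m\<in>{1..N}. \<tau> 0 \<le> real m}"
  have \<tau>0: "1 \<le> \<tau> 0" using \<tau> by auto
  have "path_sum N \<tau> 1 v u \<le> (\<Sum>m\<in>?M. path_sum N \<tau> 0 v m * edge_weight m u)"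
    using path_sum_Suc[of N \<tau> 0 v u] by simp
  also have "\<dots> \<le> (\<Sum>m\<in>?M. if m = v then edge_weight m u else 0)"
  proof (rule sum_mono)
    fix m
    have "path_sum N \<tau> 0 v m * edge_weight m u \<le> (if m = v then 1 else 0) * edge_weight m u"
      by (intro mult_right_mono path_sum_0 edge_weight_nonneg)
    thus "path_sum N \<tau> 0 v m * edge_weight m u \<le> (if m = v then edge_weight m u else 0)"
      by (auto split: if_splits)
  qed
  also have "\<dots> = (if v \<in> ?M then edge_weight v u else 0)" by simp
  also have "\<dots> \<le> \<alpha> 1 * real u powr (- \<gamma>) + (if \<tau> 0 < real u then 1 else 0) * (\<beta> 1 * real u powr (\<gamma> - 1))"
  proof (cases "v \<in> ?M")
    case True
    have kp: "0 \<le> \<kappa>" using kappa_ge_1 by simp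
    have "edge_weight v u \<le> \<kappa> * (real v powr (\<gamma> - 1) * real u powr (- \<gamma>))
       + (if \<tau> 0 < real u then 1 else 0) * (\<kappa> * (real v powr (- \<gamma>) * real u powr (\<gamma> - 1)))"
      using True base by (intro edge_weight_le) auto
    also have "\<dots> \<le> \<kappa> * (\<tau> 0 powr (\<gamma> - 1) * real u powr (- \<gamma>))
       + (if \<tau> 0 < real u then 1 else 0) * (\<kappa> * (\<tau> 0 powr (- \<gamma>) * real u powr (\<gamma> - 1)))"
      using True gamma \<tau>0 kp by (intro add_mono mult_left_mono mult_right_mono powr_mono2') auto
    also have "\<dots> = \<kappa> * \<tau> 0 powr (\<gamma> - 1) * real u powr (- \<gamma>)
       + (if \<tau> 0 < real u then 1 else 0) * (\<kappa> * \<tau> 0 powr (- \<gamma>) * real u powr (\<gamma> - 1))"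
      by (simp add: mult.assoc)
    also have "\<dots> \<le> \<alpha> 1 * real u powr (- \<gamma>) + (if \<tau> 0 < real u then 1 else 0) * (\<beta> 1 * real u powr (\<gamma> - 1))"
      using assms(4,5) by (intro add_mono mult_left_mono mult_right_mono) auto
    finally show ?thesis using True by simp
  next
    case False
    have "0 \<le> \<alpha> 1 * real u powr (- \<gamma>) + (if \<tau> 0 < real u then 1 else 0) * (\<beta> 1 * real u powr (\<gamma> - 1))"
      using nonneg by (intro add_nonneg_nonneg mult_nonneg_nonneg) auto
    thus ?thesis by (subst if_not_P[OF False])
  qed
  finally show ?case by (auto split: if_splits)
next
  case (step k)
  have kh: "1 \<le> k" "k < h" using step by auto
  have "path_sum N \<tau> (Suc k) v u \<le>
     (\<Sum>m\<in>{m\<in>{1..N}. \<tau> k \<le> real m}. path_sum N \<tau> k v m * edge_weight m u)" by (rule path_sum_Suc)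
  also have "\<dots> \<le> rec_const * (\<alpha> k * (1 + ln (real N / \<tau> k)) + \<beta> k * real N powr (2 * \<gamma> - 1)) * real u powr (- \<gamma>)
       + (if \<tau> k < real u then
            rec_const * (\<alpha> k * \<tau> k powr (- (2 * \<gamma> - 1)) + \<beta> k * (1 + ln (real N / \<tau> k))) * real u powr (\<gamma> - 1)
          else 0)"
  proof (rule sum_edge_weight_le)
    fix m assume m: "m \<in> {1..N}"
    have "path_sum N \<tau> k v m \<le> \<alpha> k * real m powr (- \<gamma>) +
       (if \<tau> (k - 1) < real m then \<beta> k * real m powr (\<gamma> - 1) else 0)"
      using step.IH[of m] kh m by auto
    also have "\<dots> \<le> \<alpha> k * real m powr (- \<gamma>) + \<beta> k * real m powr (\<gamma> - 1)"
      using nonneg by simp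
    finally show "0 \<le> path_sum N \<tau> k v m \<and> path_sum N \<tau> k v m \<le> \<alpha> k * real m powr (- \<gamma>) + \<beta> k * real m powr (\<gamma> - 1)"
      using path_sum_nonneg by auto
  qed (use \<tau>[of k] kh nonneg step.prems in auto)
  also have "\<dots> \<le> \<alpha> (Suc k) * real u powr (- \<gamma>) + (if \<tau> k < real u then \<beta> (Suc k) * real u powr (\<gamma> - 1) else 0)"
    using \<alpha>_step[OF kh] \<beta>_step[OF kh] by (auto intro!: add_mono mult_right_mono)
  finally show ?case by simp
qed

section \<open>Doubly exponential thresholds\<close>

text \<open>The exponents \<open>ln (N / \<tau> k)\<close> gain the factor \<open>\<gamma> / (1 - \<gamma>)\<close> in two steps, hence its square root in
  one step.\<close>

definition growth :: real where "growth = sqrt (\<gamma> / (1 - \<gamma>))"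

lemma growth_gt_1: "1 < growth"
  using gamma by (simp add: growth_def field_simps)

lemma growth_square: "(1 - \<gamma>) * (growth * growth) = \<gamma>"
  using gamma by (simp add: growth_def)

definition level :: "real \<Rightarrow> nat \<Rightarrow> real" where
  "level A k = A * growth ^ k"

definition threshold :: "real \<Rightarrow> real \<Rightarrow> nat \<Rightarrow> nat \<Rightarrow> real" where
  "threshold A B N k = real N * exp (B - level A k)"

text \<open>The coefficient \<open>\<alpha> k\<close> of \<open>u\<^sup>-\<^sup>\<gamma>\<close>. It is chosen so that \<open>\<alpha> k (\<tau> k)\<^sup>1\<^sup>-\<^sup>\<gamma>\<close> is exactly
  \<open>2\<^sup>-\<^sup>k exp (- (\<gamma> - 1/2) B)\<close>, which is summable over \<open>k\<close> and small for large \<open>B\<close>.\<close>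

definition old_coeff :: "real \<Rightarrow> real \<Rightarrow> nat \<Rightarrow> nat \<Rightarrow> real" where
  "old_coeff A B N k =
     real N powr (\<gamma> - 1) * exp (- B / 2) / 2 ^ k * exp ((1 - \<gamma>) * level A k)"

text \<open>The coefficient \<open>\<beta> k\<close> of \<open>u\<^sup>\<gamma>\<^sup>-\<^sup>1\<close>. It is chosen so that its contribution to the recursion for
  \<open>\<alpha> (k + 1)\<close> is exactly half of \<open>\<alpha> (k + 1)\<close>.\<close>

definition young_coeff :: "real \<Rightarrow> real \<Rightarrow> nat \<Rightarrow> nat \<Rightarrow> real" where
  "young_coeff A B N k =
     real N powr (- \<gamma>) * exp (- B / 2) / 2 ^ (k + 1) / (2 * rec_const) * exp ((1 - \<gamma>) * level A (k + 1))"

text \<open>Sufficient conditions for the recursive inequalities. First \<open>B\<close> is taken large, to beat the constant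
  factors; the factor \<open>exp (- B / 2)\<close> in both coefficients leaves room for this at the start,
  because \<open>\<gamma> > 1 / 2\<close>. Then \<open>A\<close> is taken large depending on \<open>B\<close>, so that one step of the
  exponential growth beats the logarithms \<open>ln (N / \<tau> k) = A r\<^sup>k - B\<close>.\<close>

definition admissible :: "real \<Rightarrow> real \<Rightarrow> bool" where
  "admissible A B \<longleftrightarrow> 0 \<le> B \<and> B \<le> A \<and>
     8 * rec_const * \<kappa> \<le> exp ((\<gamma> - 1 / 2) * B) \<and>
     2 * \<kappa> * exp (B / 2) \<le> exp ((1 - \<gamma>) * (growth - 1) * A) \<and>
     (\<forall>y\<ge>A. 4 * rec_const * (1 + y) \<le> exp ((1 - \<gamma>) * (growth - 1) * y))"

lemma level_Suc: "level A (Suc k) = growth * level A k"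
  by (simp add: level_def)

lemma level_mono: "0 \<le> A \<Longrightarrow> j \<le> k \<Longrightarrow> level A j \<le> level A k"
  unfolding level_def using growth_gt_1 by (intro mult_left_mono power_increasing) auto

lemma level_ge: "0 \<le> A \<Longrightarrow> A \<le> level A k"
  using level_mono[of A 0 k] by (simp add: level_def)

lemma old_coeff_nonneg: "0 \<le> old_coeff A B N k"
  by (simp add: old_coeff_def)

lemma young_coeff_nonneg: "0 \<le> young_coeff A B N k"
  using rec_const_ge by (simp add: young_coeff_def)

lemma ln_ratio_threshold: "1 \<le> N \<Longrightarrow> ln (real N / threshold A B N k) = level A k - B"
  by (simp add: threshold_def ln_div ln_mult)

lemma threshold_powr: "1 \<le> N \<Longrightarrow> threshold A B N k powr e = real N powr e * exp (e * (B - level A k))"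
  by (simp add: threshold_def powr_mult powr_def[of "exp _"])

lemma threshold_antimono: "0 \<le> A \<Longrightarrow> j \<le> k \<Longrightarrow> threshold A B N k \<le> threshold A B N j"
  unfolding threshold_def by (intro mult_left_mono) (auto intro: level_mono)

text \<open>The logarithm \<open>ln (N / \<tau> k)\<close> is linear in the level, whereas raising the level from \<open>k\<close> to \<open>k + 1\<close> gains a
  factor that is exponential in it.\<close>

lemma log_factor_absorbed:
  assumes "admissible A B"
  shows "4 * rec_const * (1 + (level A k - B)) * exp ((1 - \<gamma>) * level A k) \<le> exp ((1 - \<gamma>) * level A (Suc k))"
proof -
  have AB: "0 \<le> B" "B \<le> A" using assms by (auto simp: admissible_def)
  have "4 * rec_const * (1 + (level A k - B)) \<le> 4 * rec_const * (1 + level A k)"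
    using AB rec_const_ge by (intro mult_left_mono) auto
  also have "\<dots> \<le> exp ((1 - \<gamma>) * (growth - 1) * level A k)"
    using assms level_ge[of A k] AB by (auto simp: admissible_def)
  finally have "4 * rec_const * (1 + (level A k - B)) * exp ((1 - \<gamma>) * level A k)
      \<le> exp ((1 - \<gamma>) * (growth - 1) * level A k) * exp ((1 - \<gamma>) * level A k)"
    by (intro mult_right_mono) auto
  also have "\<dots> = exp ((1 - \<gamma>) * level A (Suc k))"
    by (simp add: exp_add[symmetric] level_Suc algebra_simps)
  finally show ?thesis .
qed

lemma old_coeff_step:
  assumes adm: "admissible A B" and N: "1 \<le> N"
  shows "rec_const * (old_coeff A B N k * (1 + ln (real N / threshold A B N k))
           + young_coeff A B N k * real N powr (2 * \<gamma> - 1)) \<le> old_coeff A B N (Suc k)"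
proof -
  let ?P = "real N powr (\<gamma> - 1) * exp (- B / 2)" and ?E = "exp ((1 - \<gamma>) * level A (Suc k))"
  have "rec_const * (old_coeff A B N k * (1 + ln (real N / threshold A B N k)))
      = ?P / 2 ^ k / 4 * (4 * rec_const * (1 + (level A k - B)) * exp ((1 - \<gamma>) * level A k))"
    using N by (simp add: old_coeff_def ln_ratio_threshold)
  also have "\<dots> \<le> ?P / 2 ^ k / 4 * ?E"
    using adm by (intro mult_left_mono log_factor_absorbed) auto
  finally have 1: "rec_const * (old_coeff A B N k * (1 + ln (real N / threshold A B N k))) \<le> ?P / 2 ^ k / 4 * ?E" .
  have "real N powr (- \<gamma>) * real N powr (2 * \<gamma> - 1) = real N powr (\<gamma> - 1)"
    by (simp add: powr_add[symmetric])
  hence "rec_const * (young_coeff A B N k * real N powr (2 * \<gamma> - 1)) = ?P / 2 ^ k / 4 * ?E"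
    using rec_const_ge by (simp add: young_coeff_def field_simps)
  with 1 have "rec_const * (old_coeff A B N k * (1 + ln (real N / threshold A B N k)))
      + rec_const * (young_coeff A B N k * real N powr (2 * \<gamma> - 1)) \<le> 2 * (?P / 2 ^ k / 4 * ?E)"
    by linarith
  also have "\<dots> = old_coeff A B N (Suc k)" by (simp add: old_coeff_def)
  finally show ?thesis by (simp add: distrib_left)
qed

text \<open>The steps from older to younger vertices produce the growth: by \<open>(1 - \<gamma>) r\<^sup>2 = \<gamma>\<close> the term
  \<open>\<alpha> k (\<tau> k)\<^sup>1\<^sup>-\<^sup>2\<^sup>\<gamma>\<close> has the same exponent \<open>\<gamma> A r\<^sup>k\<close> as \<open>\<beta> (k + 1)\<close>. The shift of the
  thresholds by \<open>B\<close> then supplies the constant.\<close>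

lemma young_coeff_step:
  assumes adm: "admissible A B" and N: "1 \<le> N"
  shows "rec_const * (old_coeff A B N k * threshold A B N k powr (- (2 * \<gamma> - 1))
           + young_coeff A B N k * (1 + ln (real N / threshold A B N k))) \<le> young_coeff A B N (Suc k)"
proof -
  let ?c = rec_const
  let ?P = "real N powr (- \<gamma>) * exp (- B / 2)" and ?E = "exp ((1 - \<gamma>) * level A (Suc (Suc k)))"
  have c: "1 \<le> ?c" "\<kappa> \<le> ?c" by (rule rec_const_ge)+
  have AB: "0 \<le> A" "0 \<le> B" using adm by (auto simp: admissible_def)
  have E: "?E = exp (\<gamma> * level A k)"
    using growth_square by (simp add: level_Suc mult.assoc[symmetric])
  have B: "16 * ?c * ?c * exp (- (2 * \<gamma> - 1) * B) \<le> 1"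
  proof -
    have "4 * ?c * 1 \<le> 8 * ?c * \<kappa>" using c kappa_ge_1 by (intro mult_mono) auto
    also have "\<dots> \<le> exp ((\<gamma> - 1 / 2) * B)" using adm by (auto simp: admissible_def)
    finally have "(4 * ?c) * (4 * ?c) \<le> exp ((\<gamma> - 1 / 2) * B) * exp ((\<gamma> - 1 / 2) * B)"
      using c by (intro mult_mono) auto
    also have "\<dots> = exp ((2 * \<gamma> - 1) * B)" by (simp add: exp_add[symmetric] algebra_simps)
    finally have "16 * ?c * ?c * exp (- (2 * \<gamma> - 1) * B) \<le> exp ((2 * \<gamma> - 1) * B) * exp (- (2 * \<gamma> - 1) * B)"
      by (intro mult_right_mono) auto
    thus ?thesis by (simp add: exp_add[symmetric] algebra_simps)
  qed
  have "real N powr (\<gamma> - 1) * real N powr (- (2 * \<gamma> - 1)) = real N powr (- \<gamma>)"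
    by (simp add: powr_add[symmetric])
  moreover have "exp ((1 - \<gamma>) * level A k) * exp (- (2 * \<gamma> - 1) * (B - level A k)) = ?E * exp (- (2 * \<gamma> - 1) * B)"
    unfolding E by (simp add: exp_add[symmetric] algebra_simps)
  ultimately have "?c * (old_coeff A B N k * threshold A B N k powr (- (2 * \<gamma> - 1)))
      = ?c * (?P / 2 ^ k * (?E * exp (- (2 * \<gamma> - 1) * B)))"
    using N unfolding old_coeff_def threshold_powr[OF N] by (simp add: field_simps)
  also have "\<dots> = ?P / 2 ^ k / (16 * ?c) * ?E * (16 * ?c * ?c * exp (- (2 * \<gamma> - 1) * B))"
    using c by (simp add: field_simps)
  also have "\<dots> \<le> ?P / 2 ^ k / (16 * ?c) * ?E * 1"
    using B c by (intro mult_left_mono) auto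
  finally have 1: "?c * (old_coeff A B N k * threshold A B N k powr (- (2 * \<gamma> - 1))) \<le> ?P / 2 ^ k / (16 * ?c) * ?E"
    by simp
  have "?c * (young_coeff A B N k * (1 + ln (real N / threshold A B N k)))
      = ?P / 2 ^ k / (16 * ?c) * (4 * ?c * (1 + (level A k - B)) * exp ((1 - \<gamma>) * level A (Suc k)))"
    using N c by (simp add: young_coeff_def ln_ratio_threshold)
  also have "\<dots> \<le> ?P / 2 ^ k / (16 * ?c) * (4 * ?c * (1 + (level A (Suc k) - B)) * exp ((1 - \<gamma>) * level A (Suc k)))"
    using c level_mono[OF AB(1), of k "Suc k"] by (intro mult_left_mono mult_right_mono) auto
  also have "\<dots> \<le> ?P / 2 ^ k / (16 * ?c) * ?E"
    using adm c by (intro mult_left_mono log_factor_absorbed) auto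
  finally have "?c * (old_coeff A B N k * threshold A B N k powr (- (2 * \<gamma> - 1)))
      + ?c * (young_coeff A B N k * (1 + ln (real N / threshold A B N k)))
      \<le> ?P / 2 ^ k / (16 * ?c) * ?E + ?P / 2 ^ k / (16 * ?c) * ?E"
    by (rule add_mono[OF 1])
  also have "\<dots> = 2 * (?P / 2 ^ k / (16 * ?c) * ?E)" by simp
  also have "\<dots> = young_coeff A B N (Suc k)" by (simp add: young_coeff_def mult_ac)
  finally show ?thesis by (simp add: distrib_left)
qed

lemma threshold_path_sum_le:
  assumes adm: "admissible A B" and N: "1 \<le> N" and h: "level A h \<le> ln (real N) + B"
    and k: "1 \<le> k" "k \<le> h" and u: "u \<in> {1..N}"
  shows "path_sum N (threshold A B N) k v u \<le> old_coeff A B N k * real u powr (- \<gamma>) +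
     (if threshold A B N (k - 1) < real u then young_coeff A B N k * real u powr (\<gamma> - 1) else 0)"
proof (rule path_sum_le[where \<tau> = "threshold A B N" and \<alpha> = "old_coeff A B N" and \<beta> = "young_coeff A B N",
      OF old_coeff_nonneg young_coeff_nonneg _ _ _ old_coeff_step[OF adm N] young_coeff_step[OF adm N] k u])
  let ?c = rec_const
  have c: "1 \<le> ?c" "\<kappa> \<le> ?c" by (rule rec_const_ge)+
  have AB: "0 \<le> A" "0 \<le> B" "B \<le> A" using adm by (auto simp: admissible_def)
  have N': "real N > 0" using N by simp
  show "1 \<le> threshold A B N k \<and> threshold A B N k \<le> real N" if "k \<le> h" for k
  proof
    have "level A k \<le> ln (real N) + B" using level_mono[of A k h] AB that h by linarith
    hence "exp (- ln (real N)) \<le> exp (B - level A k)" by simp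
    hence "real N * exp (- ln (real N)) \<le> threshold A B N k"
      unfolding threshold_def by (intro mult_left_mono) auto
    thus "1 \<le> threshold A B N k" using N' by (simp add: exp_minus)
    have "exp (B - level A k) \<le> 1" using level_ge[of A k] AB by simp
    thus "threshold A B N k \<le> real N" unfolding threshold_def by (simp add: mult_left_le)
  qed
  have L: "level A 0 = A" "level A 1 = growth * A" "level A 2 = growth * growth * A"
    by (auto simp: level_def power2_eq_square)
  show "\<kappa> * threshold A B N 0 powr (\<gamma> - 1) \<le> old_coeff A B N 1"
  proof -
    have "2 * \<kappa> * exp (B / 2) * exp ((\<gamma> - 1) * B) \<le> exp ((1 - \<gamma>) * (growth - 1) * A) * 1"
      using adm gamma AB by (intro mult_mono) (auto simp: admissible_def mult_nonpos_nonneg)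
    hence "real N powr (\<gamma> - 1) * exp (- B / 2) / 2 * exp ((1 - \<gamma>) * A) * (2 * \<kappa> * exp (B / 2) * exp ((\<gamma> - 1) * B))
        \<le> real N powr (\<gamma> - 1) * exp (- B / 2) / 2 * exp ((1 - \<gamma>) * A) * (exp ((1 - \<gamma>) * (growth - 1) * A) * 1)"
      by (intro mult_left_mono) auto
    moreover have "exp ((\<gamma> - 1) * (B - A)) = exp (- B / 2) * exp (B / 2) * (exp ((1 - \<gamma>) * A) * exp ((\<gamma> - 1) * B))"
      "exp ((1 - \<gamma>) * (growth * A)) = exp ((1 - \<gamma>) * A) * exp ((1 - \<gamma>) * (growth - 1) * A)"
      by (simp_all add: exp_add[symmetric] algebra_simps)
    ultimately show ?thesis
      unfolding threshold_powr[OF N] old_coeff_def L by (simp only: mult_ac) simp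
  qed
  show "\<kappa> * threshold A B N 0 powr (- \<gamma>) \<le> young_coeff A B N 1"
  proof -
    have e: "exp ((1 - \<gamma>) * level A (1 + 1)) = exp (\<gamma> * A)"
      using L(3) growth_square by (simp add: mult.assoc[symmetric] numeral_2_eq_2)
    have "8 * ?c * \<kappa> * exp (- \<gamma> * B) \<le> exp ((\<gamma> - 1 / 2) * B) * exp (- \<gamma> * B)"
      using adm by (intro mult_right_mono) (auto simp: admissible_def)
    also have "\<dots> = exp (- B / 2)" by (simp add: exp_add[symmetric] algebra_simps)
    finally have "\<kappa> * exp (- \<gamma> * B) \<le> exp (- B / 2) / (8 * ?c)" using c by (simp add: field_simps)
    hence "real N powr (- \<gamma>) * exp (\<gamma> * A) * (\<kappa> * exp (- \<gamma> * B))
        \<le> real N powr (- \<gamma>) * exp (\<gamma> * A) * (exp (- B / 2) / (8 * ?c))"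
      by (intro mult_left_mono) auto
    moreover have "exp (- \<gamma> * (B - A)) = exp (\<gamma> * A) * exp (- \<gamma> * B)"
      by (simp add: exp_add[symmetric] algebra_simps)
    ultimately show ?thesis
      unfolding threshold_powr[OF N] young_coeff_def e L by (simp add: mult_ac)
  qed
qed

text \<open>The paths that fall below the threshold for the first time in step \<open>k\<close>. Since \<open>\<tau> k \<le> \<tau> (k - 1)\<close>,
  only the term \<open>\<alpha> k u\<^sup>-\<^sup>\<gamma>\<close> is present, and summing it over \<open>u < \<tau> k\<close> costs \<open>(\<tau> k)\<^sup>1\<^sup>-\<^sup>\<gamma> / (1 - \<gamma>)\<close>.\<close>

lemma drop_weight_le:
  assumes adm: "admissible A B" and N: "1 \<le> N" and h: "level A h \<le> ln (real N) + B"
    and k: "1 \<le> k" "k \<le> h"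
  shows "(\<Sum>u\<in>{u\<in>{1..N}. real u < threshold A B N k}. path_sum N (threshold A B N) k v u)
     \<le> exp (- (\<gamma> - 1 / 2) * B) / (1 - \<gamma>) / 2 ^ k"
proof -
  let ?M = "{u\<in>{1..N}. real u < threshold A B N k}"
  have A: "0 \<le> A" using adm by (auto simp: admissible_def)
  have "(\<Sum>u\<in>?M. path_sum N (threshold A B N) k v u) \<le> (\<Sum>u\<in>?M. old_coeff A B N k * real u powr ((1 - \<gamma>) - 1))"
  proof (rule sum_mono)
    fix u assume u: "u \<in> ?M"
    hence "\<not> threshold A B N (k - 1) < real u"
      using threshold_antimono[OF A, of "k - 1" k B N] by auto
    thus "path_sum N (threshold A B N) k v u \<le> old_coeff A B N k * real u powr ((1 - \<gamma>) - 1)"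
      using threshold_path_sum_le[OF adm N h k, of u v] u by simp
  qed
  also have "\<dots> = old_coeff A B N k * (\<Sum>u\<in>?M. real u powr ((1 - \<gamma>) - 1))"
    by (rule sum_distrib_left[symmetric])
  also have "\<dots> \<le> old_coeff A B N k * (threshold A B N k powr (1 - \<gamma>) / (1 - \<gamma>))"
    using gamma by (intro mult_left_mono sum_powr_below_le old_coeff_nonneg) (auto simp: threshold_def)
  also have "\<dots> = exp (- (\<gamma> - 1 / 2) * B) / (1 - \<gamma>) / 2 ^ k"
  proof -
    have "real N powr (\<gamma> - 1) * real N powr (1 - \<gamma>) = 1"
      using N by (simp add: powr_add[symmetric])
    moreover have "exp (- B / 2) * (exp ((1 - \<gamma>) * level A k) * exp ((1 - \<gamma>) * (B - level A k))) = exp (- (\<gamma> - 1 / 2) * B)"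
      by (simp add: exp_add[symmetric] algebra_simps)
    moreover have "old_coeff A B N k * (threshold A B N k powr (1 - \<gamma>) / (1 - \<gamma>)) =
       (real N powr (\<gamma> - 1) * real N powr (1 - \<gamma>)) *
       (exp (- B / 2) * (exp ((1 - \<gamma>) * level A k) * exp ((1 - \<gamma>) * (B - level A k)))) / (1 - \<gamma>) / 2 ^ k"
      unfolding old_coeff_def threshold_powr[OF N] using gamma by (simp add: field_simps)
    ultimately show ?thesis by simp
  qed
  finally show ?thesis .
qed

text \<open>Crude bounds for the coefficients while the thresholds are still a power of \<open>N\<close>. The assumption concerns the level
  \<open>h + 1\<close> because \<open>young_coeff\<close> looks one level ahead.\<close>

lemma coeff_le:
  assumes A: "0 \<le> A" and B: "0 \<le> B" and h: "level A (Suc h) \<le> (1 - \<gamma>) / 2 * ln (real N)" and N: "1 \<le> N" and k: "k \<le> h"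
  shows "old_coeff A B N k \<le> real N powr ((\<gamma> - 1) / 2)"
    and "young_coeff A B N k \<le> real N powr ((1 - \<gamma>) / 2 - \<gamma>)"
proof -
  have E: "exp ((1 - \<gamma>) * level A j) \<le> real N powr ((1 - \<gamma>) / 2)" if "j \<le> Suc h" for j
  proof -
    have "0 \<le> level A j" using A level_ge[of A j] by simp
    have "(1 - \<gamma>) * level A j \<le> 1 * level A j"
      using gamma \<open>0 \<le> level A j\<close> by (intro mult_right_mono) auto
    also have "\<dots> \<le> (1 - \<gamma>) / 2 * ln (real N)" using level_mono[OF A that] h by simp
    finally show ?thesis using N by (simp add: powr_def)
  qed
  have "old_coeff A B N k \<le> real N powr (\<gamma> - 1) * 1 / 1 * real N powr ((1 - \<gamma>) / 2)"
    unfolding old_coeff_def using E[of k] k B by (intro mult_mono frac_le) auto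
  also have "\<dots> = real N powr ((\<gamma> - 1) / 2)" by (simp add: powr_add[symmetric] field_simps)
  finally show "old_coeff A B N k \<le> real N powr ((\<gamma> - 1) / 2)" .
  have "young_coeff A B N k \<le> real N powr (- \<gamma>) * 1 / 1 / 1 * real N powr ((1 - \<gamma>) / 2)"
    unfolding young_coeff_def using E[of "k + 1"] k B rec_const_ge
    one_le_power[of "2::real" "k + 1"]
    by (intro mult_mono frac_le) auto
  also have "\<dots> = real N powr ((1 - \<gamma>) / 2 - \<gamma>)" by (simp add: powr_add[symmetric] field_simps)
  finally show "young_coeff A B N k \<le> real N powr ((1 - \<gamma>) / 2 - \<gamma>)" .
qed

section \<open>First moment bounds for the distance\<close>

lemma prob_simple_path_le:
  assumes P: "prob_space M" and G: "G \<in> measurable M (count_space (graphs_on N))"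
    and pa: "\<And>p l. p ` {0..l} \<subseteq> {1..N} \<Longrightarrow> inj_on p {0..l} \<Longrightarrow>
      measure M {\<omega> \<in> space M. linked (G \<omega>) p l} \<le> path_weight p l"
    and Q: "finite Q" "\<And>p. p \<in> Q \<Longrightarrow> p ` {0..k} \<subseteq> {1..N}"
  shows "measure M {\<omega> \<in> space M. \<exists>p\<in>Q. linked (G \<omega>) p k \<and> inj_on p {0..k}} \<le> (\<Sum>p\<in>Q. path_weight p k)"
proof -
  interpret prob_space M by fact
  let ?I = "{p \<in> Q. inj_on p {0..k}}"
  have "measure M {\<omega> \<in> space M. \<exists>p\<in>Q. linked (G \<omega>) p k \<and> inj_on p {0..k}}
      = measure M (\<Union>p\<in>?I. {\<omega> \<in> space M. linked (G \<omega>) p k})"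
    by (rule arg_cong[where f = "measure M"]) auto
  also have "\<dots> \<le> (\<Sum>p\<in>?I. measure M {\<omega> \<in> space M. linked (G \<omega>) p k})"
    using Q(1) graph_event_measurable[OF G] by (intro finite_measure_subadditive_finite) auto
  also have "\<dots> \<le> (\<Sum>p\<in>?I. path_weight p k)"
    using Q(2) by (intro sum_mono pa) auto
  also have "\<dots> \<le> (\<Sum>p\<in>Q. path_weight p k)"
    using Q(1) by (intro sum_mono2 path_weight_nonneg) auto
  finally show ?thesis .
qed

lemma prob_dist_le:
  fixes \<tau> :: "nat \<Rightarrow> real"
  assumes P: "prob_space M" and G: "G \<in> measurable M (count_space (graphs_on N))"
    and pa: "\<And>p l. p ` {0..l} \<subseteq> {1..N} \<Longrightarrow> inj_on p {0..l} \<Longrightarrow>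
      measure M {\<omega> \<in> space M. linked (G \<omega>) p l} \<le> path_weight p l"
    and vw: "v \<noteq> w" "\<tau> 0 \<le> real v" "\<tau> 0 \<le> real w"
  shows "measure M {\<omega> \<in> space M. graph_dist N (G \<omega>) v w \<le> enat (2 * h)} \<le>
      (\<Sum>k=1..h. \<Sum>u\<in>{u\<in>{1..N}. real u < \<tau> k}. path_sum N \<tau> k v u)
    + (\<Sum>k=1..h. \<Sum>u\<in>{u\<in>{1..N}. real u < \<tau> k}. path_sum N \<tau> k w u)
    + (\<Sum>n=1..2*h. \<Sum>u=1..N. path_sum N \<tau> (n div 2) v u * path_sum N \<tau> (n - n div 2) w u)"
proof -
  interpret prob_space M by fact
  define Ev where "Ev Q k = {\<omega> \<in> space M. \<exists>p\<in>Q. linked (G \<omega>) p k \<and> inj_on p {0..k}}"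
    for Q :: "(nat \<Rightarrow> nat) set" and k
  have mEv: "Ev Q k \<in> sets M" for Q k
    unfolding Ev_def by (rule graph_event_measurable[OF G])
  define Bad where "Bad x = (\<Union>k\<in>{1..h}. \<Union>u\<in>{u\<in>{1..N}. real u < \<tau> k}. Ev (truncated_paths N \<tau> k x u) k)" for x
  define Good where "Good = (\<Union>n\<in>{1..2*h}. Ev (two_sided_paths N \<tau> (n div 2) (n - n div 2) v w) n)"
  have mBad: "Bad x \<in> sets M" for x unfolding Bad_def using mEv by (intro sets.finite_UN) auto
  have mGood: "Good \<in> sets M" unfolding Good_def using mEv by (intro sets.finite_UN) auto
  have Bad: "measure M (Bad x) \<le> (\<Sum>k=1..h. \<Sum>u\<in>{u\<in>{1..N}. real u < \<tau> k}. path_sum N \<tau> k x u)" for x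
  proof -
    have "measure M (Bad x) \<le>
        (\<Sum>k=1..h. measure M (\<Union>u\<in>{u\<in>{1..N}. real u < \<tau> k}. Ev (truncated_paths N \<tau> k x u) k))"
      unfolding Bad_def using mEv by (intro finite_measure_subadditive_finite) (auto intro!: sets.finite_UN)
    also have "\<dots> \<le> (\<Sum>k=1..h. \<Sum>u\<in>{u\<in>{1..N}. real u < \<tau> k}. measure M (Ev (truncated_paths N \<tau> k x u) k))"
      using mEv by (intro sum_mono finite_measure_subadditive_finite) auto
    also have "\<dots> \<le> (\<Sum>k=1..h. \<Sum>u\<in>{u\<in>{1..N}. real u < \<tau> k}. path_sum N \<tau> k x u)"
      unfolding Ev_def path_sum_def
      by (intro sum_mono prob_simple_path_le[OF P G pa finite_truncated_paths]) (auto simp: truncated_paths_def)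
    finally show ?thesis .
  qed
  have Good: "measure M Good \<le> (\<Sum>n=1..2*h. \<Sum>u=1..N. path_sum N \<tau> (n div 2) v u * path_sum N \<tau> (n - n div 2) w u)"
  proof -
    have "measure M Good \<le> (\<Sum>n=1..2*h. measure M (Ev (two_sided_paths N \<tau> (n div 2) (n - n div 2) v w) n))"
      unfolding Good_def using mEv by (intro finite_measure_subadditive_finite) auto
    also have "\<dots> \<le> (\<Sum>n=1..2*h. \<Sum>u=1..N. path_sum N \<tau> (n div 2) v u * path_sum N \<tau> (n - n div 2) w u)"
    proof (rule sum_mono)
      fix n
      have "measure M (Ev (two_sided_paths N \<tau> (n div 2) (n - n div 2) v w) n)
         \<le> (\<Sum>p\<in>two_sided_paths N \<tau> (n div 2) (n - n div 2) v w. path_weight p n)"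
        unfolding Ev_def by (intro prob_simple_path_le[OF P G pa finite_two_sided_paths]) (auto simp: two_sided_paths_def)
      also have "\<dots> \<le> (\<Sum>u=1..N. path_sum N \<tau> (n div 2) v u * path_sum N \<tau> (n - n div 2) w u)"
        using two_sided_sum_le[where a = "n div 2" and b = "n - n div 2"] by simp
      finally show "measure M (Ev (two_sided_paths N \<tau> (n div 2) (n - n div 2) v w) n) \<le>
        (\<Sum>u=1..N. path_sum N \<tau> (n div 2) v u * path_sum N \<tau> (n - n div 2) w u)" .
    qed
    finally show ?thesis .
  qed
  have "{\<omega> \<in> space M. graph_dist N (G \<omega>) v w \<le> enat (2 * h)} \<subseteq> Bad v \<union> Bad w \<union> Good"
  proof
    fix \<omega> assume "\<omega> \<in> {\<omega> \<in> space M. graph_dist N (G \<omega>) v w \<le> enat (2 * h)}"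
    hence \<omega>: "\<omega> \<in> space M" and d: "graph_dist N (G \<omega>) v w \<le> enat (2 * h)" by auto
    have sym: "sym (G \<omega>)" using measurable_space[OF G \<omega>] by (auto simp: graphs_on_def)
    from graph_dist_le_imp_path[OF d] obtain p n where p: "n \<le> 2 * h" "p 0 = v" "p n = w"
      "p ` {0..n} \<subseteq> {1..N}" "linked (G \<omega>) p n" "inj_on p {0..n}" by blast
    have n: "n \<in> {1..2*h}" using p vw(1) by (cases n) auto
    from sym p(4,2,3,5,6,1) vw(2,3) show "\<omega> \<in> Bad v \<union> Bad w \<union> Good"
    proof (cases rule: simple_path_cases)
      case (left k u q)
      thus ?thesis using \<omega> unfolding Bad_def Ev_def by blast
    next
      case (right k u q)
      thus ?thesis using \<omega> unfolding Bad_def Ev_def by blast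
    next
      case (good q)
      thus ?thesis using \<omega> n unfolding Good_def Ev_def by blast
    qed
  qed
  hence "measure M {\<omega> \<in> space M. graph_dist N (G \<omega>) v w \<le> enat (2 * h)} \<le> measure M (Bad v \<union> Bad w \<union> Good)"
    using mBad mGood by (intro finite_measure_mono) auto
  also have "\<dots> \<le> measure M (Bad v \<union> Bad w) + measure M Good"
    using mBad mGood by (intro measure_Un_le) auto
  also have "measure M (Bad v \<union> Bad w) \<le> measure M (Bad v) + measure M (Bad w)"
    using mBad by (intro measure_Un_le) auto
  finally show ?thesis using Bad[of v] Bad[of w] Good by linarith
qed

text \<open>Two truncated paths of half the length rarely meet. With both coefficients replaced by the bounds
  \<open>x\<close> and \<open>y\<close> for level \<open>h\<close>, the sum over the meeting point is of order \<open>x\<^sup>2 + y\<^sup>2 N\<^sup>2\<^sup>\<gamma>\<^sup>-\<^sup>1\<close>, a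
  negative power of \<open>N\<close>. For \<open>n = 1\<close> the first path is trivial, which leaves the bound for a
  single edge.\<close>

lemma meeting_weight_le:
  assumes adm: "admissible A B" and N: "1 \<le> N" and h: "level A (Suc h) \<le> (1 - \<gamma>) / 2 * ln (real N)"
    and n: "1 \<le> n" "n \<le> 2 * h" and v: "v \<in> {1..N}"
  shows "(\<Sum>u=1..N. path_sum N (threshold A B N) (n div 2) v u * path_sum N (threshold A B N) (n - n div 2) w u)
     \<le> (2 + 4 / (2 * \<gamma> - 1)) * real N powr ((\<gamma> - 1) / 2)"
proof -
  define s where "s = 2 * \<gamma> - 1"
  have s: "0 < s" "s \<le> 1" using gamma by (auto simp: s_def)
  define x y where "x = real N powr ((\<gamma> - 1) / 2)" and "y = real N powr ((1 - \<gamma>) / 2 - \<gamma>)"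
  have xy: "0 \<le> x" "0 \<le> y" by (auto simp: x_def y_def)
  have AB: "0 \<le> A" "0 \<le> B" using adm by (auto simp: admissible_def)
  have "level A h \<le> level A (Suc h)" using AB by (intro level_mono) auto
  also have "\<dots> \<le> 1 * ln (real N)"
    using h gamma N by (intro order_trans[OF h] mult_right_mono) auto
  finally have h': "level A h \<le> ln (real N) + B" using AB by simp
  have bound: "path_sum N (threshold A B N) k z u \<le> x * real u powr (- \<gamma>) + y * real u powr (\<gamma> - 1)"
    if "1 \<le> k" "k \<le> h" "u \<in> {1..N}" for k z u
  proof -
    have "path_sum N (threshold A B N) k z u \<le> old_coeff A B N k * real u powr (- \<gamma>) +
     (if threshold A B N (k - 1) < real u then young_coeff A B N k * real u powr (\<gamma> - 1) else 0)"
      using that by (intro threshold_path_sum_le[OF adm N h']) auto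
    also have "\<dots> \<le> old_coeff A B N k * real u powr (- \<gamma>) + young_coeff A B N k * real u powr (\<gamma> - 1)"
      using young_coeff_nonneg[of A B N k] by simp
    also have "\<dots> \<le> x * real u powr (- \<gamma>) + y * real u powr (\<gamma> - 1)"
      unfolding x_def y_def using coeff_le[OF AB h N \<open>k \<le> h\<close>] by (intro add_mono mult_right_mono) auto
    finally show ?thesis .
  qed
  let ?S = "\<Sum>u=1..N. path_sum N (threshold A B N) (n div 2) v u * path_sum N (threshold A B N) (n - n div 2) w u"
  have yx: "y \<le> x" unfolding x_def y_def using N gamma by (intro powr_mono) (auto simp: field_simps)
  have x1: "x \<le> 1" unfolding x_def using N gamma powr_mono[of "(\<gamma> - 1) / 2" 0 "real N"] by simp
  show ?thesis
  proof (cases "n = 1")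
    case True
    have "?S \<le> (\<Sum>u=1..N. if u = v then path_sum N (threshold A B N) 1 w u else 0)"
    proof (rule sum_mono)
      fix u
      have "path_sum N (threshold A B N) 0 v u * path_sum N (threshold A B N) 1 w u
          \<le> (if u = v then 1 else 0) * path_sum N (threshold A B N) 1 w u"
        by (intro mult_right_mono path_sum_0 path_sum_nonneg)
      thus "path_sum N (threshold A B N) (n div 2) v u * path_sum N (threshold A B N) (n - n div 2) w u
          \<le> (if u = v then path_sum N (threshold A B N) 1 w u else 0)"
        using True by (auto split: if_splits)
    qed
    also have "\<dots> = path_sum N (threshold A B N) 1 w v" using v by simp
    also have "\<dots> \<le> x * real v powr (- \<gamma>) + y * real v powr (\<gamma> - 1)"
      using n True v by (intro bound) auto
    also have "\<dots> \<le> x * 1 + x * 1"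
      using v gamma xy yx powr_mono[of "- \<gamma>" 0 "real v"] powr_mono[of "\<gamma> - 1" 0 "real v"]
      by (intro add_mono mult_mono) auto
    also have "\<dots> \<le> (2 + 4 / s) * x" using s xy by (simp add: algebra_simps)
    finally show ?thesis unfolding s_def x_def .
  next
    case False
    have ab: "1 \<le> n div 2" "n div 2 \<le> h" "1 \<le> n - n div 2" "n - n div 2 \<le> h" using n False by auto
    have "?S \<le> (\<Sum>u=1..N. 2 * (x * x) * real u powr (- 1 - s) + 2 * (y * y) * real u powr (s - 1))"
    proof (rule sum_mono)
      fix u assume u: "u \<in> {1..N}"
      define p q where "p = x * real u powr (- \<gamma>)" and "q = y * real u powr (\<gamma> - 1)"
      have "path_sum N (threshold A B N) (n div 2) v u * path_sum N (threshold A B N) (n - n div 2) w u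
        \<le> (p + q) * (p + q)"
        unfolding p_def q_def using u ab xy by (intro mult_mono bound path_sum_nonneg) auto
      also have "\<dots> \<le> 2 * (p * p) + 2 * (q * q)"
        using zero_le_square[of "p - q"] by (simp add: algebra_simps)
      also have "p * p = x * x * real u powr (- 1 - s)"
        by (simp add: p_def s_def powr_add[symmetric] mult_ac)
      also have "q * q = y * y * real u powr (s - 1)"
        by (simp add: q_def s_def powr_add[symmetric] mult_ac)
      finally show "path_sum N (threshold A B N) (n div 2) v u * path_sum N (threshold A B N) (n - n div 2) w u
        \<le> 2 * (x * x) * real u powr (- 1 - s) + 2 * (y * y) * real u powr (s - 1)" by (simp add: mult.assoc)
    qed
    also have "\<dots> = 2 * (x * x) * (\<Sum>u=1..N. real u powr (- 1 - s)) + 2 * (y * y) * (\<Sum>u=1..N. real u powr (s - 1))"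
      by (simp add: sum.distrib sum_distrib_left)
    also have "\<dots> \<le> 2 * (x * x) * (1 + 1 / s) + 2 * (y * y) * (real N powr s / s)"
    proof -
      have "(\<Sum>u=1..N. real u powr (- 1 - s)) = (\<Sum>u\<in>{u\<in>{1..N}. 1 \<le> real u}. real u powr (- 1 - s))"
        by (rule sum.cong) auto
      also have "\<dots> \<le> (1 + 1 / s) * 1 powr (- s)" using s N by (intro sum_powr_above_le) auto
      finally show ?thesis using sum_powr_le[OF s, of N] by (intro add_mono mult_left_mono) auto
    qed
    also have "y * y = real N powr (1 - 3 * \<gamma>)" by (simp add: y_def powr_add[symmetric])
    also have "2 * real N powr (1 - 3 * \<gamma>) * (real N powr s / s) = 2 / s * (real N powr (- \<gamma>))"
      by (simp add: s_def powr_add[symmetric])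
    also have "\<dots> \<le> 2 / s * x"
      unfolding x_def using s N gamma by (intro mult_left_mono powr_mono) auto
    also have "2 * (x * x) * (1 + 1 / s) \<le> 2 * (x * 1) * (1 + 1 / s)"
      using xy s x1 by (intro mult_right_mono mult_left_mono) auto
    finally have "?S \<le> (2 + 4 / s) * x" by (simp add: algebra_simps)
    thus ?thesis unfolding s_def x_def .
  qed
qed

lemma prob_dist_le_threshold:
  assumes adm: "admissible A B" and N: "1 \<le> N" and h: "level A (Suc h) \<le> (1 - \<gamma>) / 2 * ln (real N)"
    and P: "prob_space M" and G: "G \<in> measurable M (count_space (graphs_on N))"
    and pa: "\<And>p l. p ` {0..l} \<subseteq> {1..N} \<Longrightarrow> inj_on p {0..l} \<Longrightarrow>
      measure M {\<omega> \<in> space M. linked (G \<omega>) p l} \<le> path_weight p l"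
    and vw: "v \<in> {1..N}" "v \<noteq> w" "threshold A B N 0 \<le> real v" "threshold A B N 0 \<le> real w"
  shows "measure M {\<omega> \<in> space M. graph_dist N (G \<omega>) v w \<le> enat (2 * h)} \<le>
      2 * (exp (- (\<gamma> - 1 / 2) * B) / (1 - \<gamma>)) + 2 * real h * ((2 + 4 / (2 * \<gamma> - 1)) * real N powr ((\<gamma> - 1) / 2))"
proof -
  let ?\<tau> = "threshold A B N" and ?d = "exp (- (\<gamma> - 1 / 2) * B) / (1 - \<gamma>)"
  have AB: "0 \<le> A" "0 \<le> B" using adm by (auto simp: admissible_def)
  have "level A h \<le> level A (Suc h)" using AB by (intro level_mono) auto
  also have "\<dots> \<le> 1 * ln (real N)"
    using h gamma N by (intro order_trans[OF h] mult_right_mono) auto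
  finally have h': "level A h \<le> ln (real N) + B" using AB by simp
  have geo: "(\<Sum>k=1..h. ?d / 2 ^ k) \<le> ?d"
  proof -
    have "(\<Sum>k=1..h. d / 2 ^ k) = d * (1 - (1 / 2) ^ h)" for d :: real
      by (induction h) (auto simp: field_simps)
    hence "(\<Sum>k=1..h. ?d / 2 ^ k) = ?d * (1 - (1 / 2) ^ h)" .
    also have "\<dots> \<le> ?d" using gamma by (intro mult_left_le) auto
    finally show ?thesis .
  qed
  have drop: "(\<Sum>k=1..h. \<Sum>u\<in>{u\<in>{1..N}. real u < ?\<tau> k}. path_sum N ?\<tau> k z u) \<le> ?d" for z
    by (intro order_trans[OF sum_mono geo] drop_weight_le[OF adm N h']) auto
  have "(\<Sum>n=1..2*h. \<Sum>u=1..N. path_sum N ?\<tau> (n div 2) v u * path_sum N ?\<tau> (n - n div 2) w u)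
      \<le> (\<Sum>n=1..2*h. (2 + 4 / (2 * \<gamma> - 1)) * real N powr ((\<gamma> - 1) / 2))"
    by (intro sum_mono meeting_weight_le[OF adm N h]) (use vw in auto)
  also have "\<dots> = 2 * real h * ((2 + 4 / (2 * \<gamma> - 1)) * real N powr ((\<gamma> - 1) / 2))" by simp
  finally show ?thesis
    using prob_dist_le[where \<tau> = ?\<tau> and h = h, OF P G pa vw(2-4)] drop[of v] drop[of w] by linarith
qed

section \<open>Choice of the parameters\<close>

text \<open>The choice of \<open>B\<close> makes the probability of dropping below a threshold small, and the choice of \<open>A\<close> makes it
  unlikely that a uniform vertex lies below \<open>\<tau> 0 = N exp (B - A)\<close>.\<close>

lemma exists_admissible:
  assumes "0 < \<epsilon>"
  obtains A B where "admissible A B" "exp (- (\<gamma> - 1 / 2) * B) / (1 - \<gamma>) \<le> \<epsilon>" "exp (B - A) \<le> \<epsilon>"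
proof -
  define e where "e = \<gamma> - 1 / 2"
  have e: "0 < e" using gamma by (simp add: e_def)
  have g: "0 < 1 - \<gamma>" using gamma by simp
  have "eventually (\<lambda>B::real. 0 \<le> B \<and> 8 * rec_const * \<kappa> \<le> exp (e * B) \<and> exp (- e * B) / (1 - \<gamma>) \<le> \<epsilon>) at_top"
  proof (intro eventually_conj)
    show "eventually (\<lambda>B::real. 8 * rec_const * \<kappa> \<le> exp (e * B)) at_top" using e by real_asymp
    have "((\<lambda>B. exp (- e * B)) \<longlongrightarrow> 0) at_top" using e by real_asymp
    hence "((\<lambda>B. exp (- e * B) / (1 - \<gamma>)) \<longlongrightarrow> 0) at_top" by (rule tendsto_divide_zero)
    from order_tendstoD(2)[OF this assms] show "eventually (\<lambda>B::real. exp (- e * B) / (1 - \<gamma>) \<le> \<epsilon>) at_top"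
      by eventually_elim simp
  qed (rule eventually_ge_at_top)
  then obtain B :: real where B: "0 \<le> B" "8 * rec_const * \<kappa> \<le> exp (e * B)" "exp (- e * B) / (1 - \<gamma>) \<le> \<epsilon>"
    by (auto simp: eventually_at_top_linorder)
  define d where "d = (1 - \<gamma>) * (growth - 1)"
  have d: "0 < d" using growth_gt_1 g by (simp add: d_def)
  have "eventually (\<lambda>A::real. B \<le> A \<and> 2 * \<kappa> * exp (B / 2) \<le> exp (d * A) \<and>
      (\<forall>y\<ge>A. 4 * rec_const * (1 + y) \<le> exp (d * y)) \<and> exp (B - A) \<le> \<epsilon>) at_top"
  proof (intro eventually_conj)
    show "eventually (\<lambda>A::real. 2 * \<kappa> * exp (B / 2) \<le> exp (d * A)) at_top" using d by real_asymp
    have "eventually (\<lambda>y::real. 4 * rec_const * (1 + y) \<le> exp (d * y)) at_top"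
      using d rec_const_ge by real_asymp
    thus "eventually (\<lambda>A::real. \<forall>y\<ge>A. 4 * rec_const * (1 + y) \<le> exp (d * y)) at_top"
      by (rule eventually_all_ge_at_top)
    have "((\<lambda>A. exp (B - A)) \<longlongrightarrow> 0) at_top" by real_asymp
    from order_tendstoD(2)[OF this assms] show "eventually (\<lambda>A::real. exp (B - A) \<le> \<epsilon>) at_top"
      by eventually_elim simp
  qed (rule eventually_ge_at_top)
  then obtain A :: real where A: "B \<le> A" "2 * \<kappa> * exp (B / 2) \<le> exp (d * A)"
    "\<forall>y\<ge>A. 4 * rec_const * (1 + y) \<le> exp (d * y)" "exp (B - A) \<le> \<epsilon>"
    by (auto simp: eventually_at_top_linorder)
  show thesis using A B by (intro that[of A B]) (auto simp: admissible_def d_def e_def)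
qed

text \<open>Up to a constant, \<open>2h\<close> is the largest length that the bound on the level \<open>h + 1\<close> in the preceding
  lemmas permits. Since that bound is a multiple of \<open>ln N\<close> and the level is a multiple of \<open>r\<^sup>h\<close>, the constants only
  shift \<open>h\<close> by the constant \<open>K\<close>. The error probability \<open>\<epsilon>\<close> is divided among two unlikely endpoints, two sides on which a
  path may drop, the meeting of two truncated paths, and the coincidence of the endpoints.\<close>

lemma whp_distance:
  assumes nm: "network_model M G" and uv: "uniform_vertices M G V W"
    and pa: "\<And>N p l. p ` {0..l} \<subseteq> {1..N} \<Longrightarrow> inj_on p {0..l} \<Longrightarrow>
      measure (M N) {\<omega> \<in> space (M N). linked (G N \<omega>) p l} \<le> path_weight p l"
  shows "whp_ge_plus_O1 M
           (\<lambda>N \<omega>. graph_dist N (G N \<omega>) (V N \<omega>) (W N \<omega>))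
           (\<lambda>N. 4 * (ln (ln (real N)) / ln (\<gamma> / (1 - \<gamma>))))"
  unfolding whp_ge_plus_O1_def
proof (intro allI impI)
  fix \<epsilon> :: real assume "0 < \<epsilon>"
  define \<delta> where "\<delta> = \<epsilon> / 8"
  have \<delta>: "0 < \<delta>" using \<open>0 < \<epsilon>\<close> by (simp add: \<delta>_def)
  obtain A B where adm: "admissible A B" and B: "exp (- (\<gamma> - 1 / 2) * B) / (1 - \<gamma>) \<le> \<delta>"
    and A: "exp (B - A) \<le> \<delta>"
    using exists_admissible[OF \<delta>] by blast
  have A0: "0 \<le> A" using adm by (auto simp: admissible_def)
  obtain K :: nat where K: "2 * A * growth / (1 - \<gamma>) < growth ^ K"
    using real_arch_pow[OF growth_gt_1] by blast
  have lng: "0 < ln growth" using growth_gt_1 by simp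
  have lnq: "ln (\<gamma> / (1 - \<gamma>)) = 2 * ln growth"
    using gamma unfolding growth_def by (simp add: ln_sqrt)
  define \<nu> where "\<nu> N = ln (ln (real N)) / ln growth" for N
  define c where "c = 2 + 4 / (2 * \<gamma> - 1)"
  have c: "0 \<le> c" using gamma by (simp add: c_def)
  \<comment> \<open>the shift of both halves by \<open>K\<close>, and the rounding of \<open>h\<close>\<close>
  define C where "C = 2 * real K + 2"
  have ev: "eventually (\<lambda>N. real K \<le> \<nu> N \<and> 2 * \<nu> N * (c * real N powr ((\<gamma> - 1) / 2)) \<le> \<delta>
      \<and> 1 / real N \<le> \<delta> \<and> N \<ge> 3) sequentially"
  proof (intro eventually_conj)
    show "eventually (\<lambda>N. real K \<le> \<nu> N) sequentially"
      unfolding \<nu>_def using lng by real_asymp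
    have "(\<lambda>N. 2 * \<nu> N * (c * real N powr ((\<gamma> - 1) / 2))) \<longlonglongrightarrow> 0"
      unfolding \<nu>_def using lng gamma by real_asymp
    from order_tendstoD(2)[OF this \<delta>]
    show "eventually (\<lambda>N. 2 * \<nu> N * (c * real N powr ((\<gamma> - 1) / 2)) \<le> \<delta>) sequentially"
      by eventually_elim simp
    have "(\<lambda>N. 1 / real N) \<longlonglongrightarrow> 0" by real_asymp
    from order_tendstoD(2)[OF this \<delta>]
    show "eventually (\<lambda>N. 1 / real N \<le> \<delta>) sequentially" by eventually_elim simp
  qed (rule eventually_ge_at_top)
  have "eventually (\<lambda>N. 1 - \<epsilon> \<le> measure (M N) {\<omega> \<in> space (M N).
      ereal (4 * (ln (ln (real N)) / ln (\<gamma> / (1 - \<gamma>))) - C)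
      \<le> ereal_of_enat (graph_dist N (G N \<omega>) (V N \<omega>) (W N \<omega>))}) sequentially"
    using ev
  proof eventually_elim
    case (elim N)
    hence N: "1 \<le> N" and \<nu>: "real K \<le> \<nu> N" and small: "2 * \<nu> N * (c * real N powr ((\<gamma> - 1) / 2)) \<le> \<delta>"
      and invN: "1 / real N \<le> \<delta>" by auto
    have lnN: "0 < ln (real N)" using elim by simp
    define h where "h = nat \<lfloor>\<nu> N - real K\<rfloor>"
    have h: "real h \<le> \<nu> N - real K" "\<nu> N - real K \<le> real h + 1" using \<nu> unfolding h_def by linarith+
    interpret prob_space "M N" using nm N by (auto simp: network_model_def)
    have G: "G N \<in> measurable (M N) (count_space (graphs_on N))" using nm N by (auto simp: network_model_def)
    have level: "level A (Suc h) \<le> (1 - \<gamma>) / 2 * ln (real N)"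
    proof -
      have "growth ^ (h + K) = exp (real (h + K) * ln growth)"
        by (subst exp_of_nat_mult) (use growth_gt_1 in simp)
      also have "\<dots> \<le> exp (\<nu> N * ln growth)" using h lng by simp
      also have "\<dots> = ln (real N)" using lng lnN by (simp add: \<nu>_def)
      finally have pw: "growth ^ h * growth ^ K \<le> ln (real N)" by (simp add: power_add)
      have "level A (Suc h) = (1 - \<gamma>) / 2 * (growth ^ h * (2 * A * growth / (1 - \<gamma>)))"
        using gamma by (simp add: level_def)
      also have "\<dots> \<le> (1 - \<gamma>) / 2 * (growth ^ h * growth ^ K)"
        using K gamma growth_gt_1 by (intro mult_left_mono) auto
      also have "\<dots> \<le> (1 - \<gamma>) / 2 * ln (real N)" using pw gamma by (intro mult_left_mono) auto
      finally show ?thesis .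
    qed
    let ?\<tau> = "threshold A B N 0"
    define f where "f v w = measure (M N) {\<omega> \<in> space (M N). graph_dist N (G N \<omega>) v w \<le> enat (2 * h)}" for v w
    have f: "f v w \<le> 3 * \<delta> + ((if real v < ?\<tau> then 1 else 0) + (if real w < ?\<tau> then 1 else 0) + (if w = v then 1 else 0))"
      if "v \<in> {1..N}" "w \<in> {1..N}" for v w
    proof (cases "real v < ?\<tau> \<or> real w < ?\<tau> \<or> w = v")
      case True
      have "f v w \<le> 1" unfolding f_def by simp
      thus ?thesis using True \<delta> by auto
    next
      case False
      have "f v w \<le> 2 * (exp (- (\<gamma> - 1 / 2) * B) / (1 - \<gamma>)) + 2 * real h * (c * real N powr ((\<gamma> - 1) / 2))"
        unfolding f_def c_def using False that
        by (intro prob_dist_le_threshold[OF adm N level prob_space_axioms G pa]) auto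
      also have "2 * real h * (c * real N powr ((\<gamma> - 1) / 2)) \<le> 2 * \<nu> N * (c * real N powr ((\<gamma> - 1) / 2))"
        using h c by (intro mult_right_mono) auto
      finally have "f v w \<le> 3 * \<delta>" using B small by linarith
      thus ?thesis using False by auto
    qed
    have card: "(\<Sum>v=1..N. if real v < ?\<tau> then 1 else 0 :: real) \<le> real N * \<delta>"
    proof -
      have "(\<Sum>v=1..N. if real v < ?\<tau> then 1 else 0 :: real) = real (card {v\<in>{1..N}. real v < ?\<tau>})"
        by (subst sum.inter_filter[symmetric]) auto
      also have "\<dots> \<le> real (card {1..nat \<lfloor>?\<tau>\<rfloor>})"
        by (intro of_nat_mono card_mono) (auto simp: le_nat_floor)
      also have "\<dots> \<le> ?\<tau>" by (simp add: threshold_def)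
      also have "\<dots> \<le> real N * \<delta>" using A by (auto simp: threshold_def level_def intro: mult_left_mono)
      finally show ?thesis .
    qed
    let ?short = "{\<omega> \<in> space (M N). graph_dist N (G N \<omega>) (V N \<omega>) (W N \<omega>) \<le> enat (2 * h)}"
    note avg = uniform_vertices_average[OF uv nm N, where Q = "\<lambda>E v w. graph_dist N E v w \<le> enat (2 * h)"]
    have "measure (M N) ?short = (\<Sum>v=1..N. \<Sum>w=1..N. f v w) / (real N)\<^sup>2"
      unfolding f_def by (rule avg(2))
    also have "\<dots> \<le> (\<Sum>v=1..N. \<Sum>w=1..N. 3 * \<delta> + ((if real v < ?\<tau> then 1 else 0)
        + (if real w < ?\<tau> then 1 else 0) + (if w = v then 1 else 0))) / (real N)\<^sup>2"
      using f by (intro divide_right_mono sum_mono) auto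
    also have "(\<Sum>v=1..N. \<Sum>w=1..N. 3 * \<delta> + ((if real v < ?\<tau> then 1 else 0)
        + (if real w < ?\<tau> then 1 else 0) + (if w = v then 1 else 0 :: real)))
       = real N * (real N * (3 * \<delta>)) + (real N * (\<Sum>v=1..N. if real v < ?\<tau> then 1 else 0)
        + real N * (\<Sum>v=1..N. if real v < ?\<tau> then 1 else 0) + real N)"
      by (simp add: sum.distrib sum_distrib_left[symmetric])
    also have "\<dots> / (real N)\<^sup>2 \<le> (real N * (real N * (3 * \<delta>)) + (real N * (real N * \<delta>)
        + real N * (real N * \<delta>) + real N * (real N * \<delta>))) / (real N)\<^sup>2"
      using card invN N by (intro divide_right_mono add_mono mult_left_mono) (auto simp: field_simps)
    also have "\<dots> = 6 * \<delta>" using N by (simp add: power2_eq_square field_simps)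
    also have "\<dots> \<le> \<epsilon>" using \<open>0 < \<epsilon>\<close> by (simp add: \<delta>_def)
    finally have short: "measure (M N) ?short \<le> \<epsilon>" .
    let ?long = "{\<omega> \<in> space (M N). ereal (4 * (ln (ln (real N)) / ln (\<gamma> / (1 - \<gamma>))) - C)
      \<le> ereal_of_enat (graph_dist N (G N \<omega>) (V N \<omega>) (W N \<omega>))}"
    have "1 - measure (M N) ?short = measure (M N) (space (M N) - ?short)"
      using avg(1) by (simp add: prob_compl)
    also have "\<dots> \<le> measure (M N) ?long"
    proof (rule finite_measure_mono)
      show "?long \<in> sets (M N)"
        by (rule uniform_vertices_average(1)[OF uv nm N])
      have eq: "4 * (ln (ln (real N)) / ln (\<gamma> / (1 - \<gamma>))) - C \<le> real (2 * h)"
        using h unfolding lnq C_def \<nu>_def by simp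
      have "ereal (4 * (ln (ln (real N)) / ln (\<gamma> / (1 - \<gamma>))) - C) \<le> ereal_of_enat d"
        if "\<not> d \<le> enat (2 * h)" for d
        using that eq by (cases d) auto
      thus "space (M N) - ?short \<subseteq> ?long" by blast
    qed
    finally show ?case using short by linarith
  qed
  thus "\<exists>C. eventually (\<lambda>N. 1 - \<epsilon> \<le> measure (M N) {\<omega> \<in> space (M N).
      ereal (4 * (ln (ln (real N)) / ln (\<gamma> / (1 - \<gamma>))) - C)
      \<le> ereal_of_enat (graph_dist N (G N \<omega>) (V N \<omega>) (W N \<omega>))}) sequentially" by blast
qed

end

theorem theorem1:
  fixes M :: "nat \<Rightarrow> 'a measure"
    and G :: "nat \<Rightarrow> 'a \<Rightarrow> (nat \<times> nat) set"
    and V W :: "nat \<Rightarrow> 'a \<Rightarrow> nat"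
    and \<gamma> :: real
  assumes "1 / 2 < \<gamma>" and "\<gamma> < 1"
    and "network_model M G"
    and "PA \<gamma> M G"
    and "uniform_vertices M G V W"
  shows "whp_ge_plus_O1 M
           (\<lambda>N \<omega>. graph_dist N (G N \<omega>) (V N \<omega>) (W N \<omega>))
           (\<lambda>N. 4 * (ln (ln (real N)) / ln (\<gamma> / (1 - \<gamma>))))"
proof -
  obtain \<kappa> where \<kappa>: "\<And>N l p. p ` {0..l} \<subseteq> {1..N} \<Longrightarrow> inj_on p {0..l} \<Longrightarrow>
      measure (M N) {\<omega> \<in> space (M N). linked (G N \<omega>) p l} \<le>
      (\<Prod>k = 1..l. \<kappa> * real (min (p (k - 1)) (p k)) powr (- \<gamma>) * real (max (p (k - 1)) (p k)) powr (\<gamma> - 1))"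
    using assms(4) unfolding PA_def by blast
  interpret pa_weights "max 1 \<bar>\<kappa>\<bar>" \<gamma>
    using assms by unfold_locales auto
  show ?thesis
  proof (rule whp_distance[OF assms(3,5)])
    fix N l and p :: "nat \<Rightarrow> nat" assume p: "p ` {0..l} \<subseteq> {1..N}" "inj_on p {0..l}"
    have "measure (M N) {\<omega> \<in> space (M N). linked (G N \<omega>) p l} \<le>
      \<bar>\<Prod>k = 1..l. \<kappa> * real (min (p (k - 1)) (p k)) powr (- \<gamma>) * real (max (p (k - 1)) (p k)) powr (\<gamma> - 1)\<bar>"
      using \<kappa>[OF p] by linarith
    also have "\<dots> = (\<Prod>k = 1..l. \<bar>\<kappa>\<bar> * real (min (p (k - 1)) (p k)) powr (- \<gamma>) * real (max (p (k - 1)) (p k)) powr (\<gamma> - 1))"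
      by (simp add: abs_prod abs_mult)
    also have "\<dots> \<le> path_weight p l"
      unfolding path_weight_def edge_weight_def by (intro prod_mono conjI mult_right_mono) auto
    finally show "measure (M N) {\<omega> \<in> space (M N). linked (G N \<omega>) p l} \<le> path_weight p l" .
  qed
qed

end
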